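(* For every integer $d\ge1$ there is a constant $c_d>0$ such that the following holds. Let $P$ be a set of $n$ points in $\mathbb R^d$, let $\psi,\varepsilon\in(0,1)$, and put $C_\varepsilon=c_d\,\varepsilon^{-d}\log(2/\varepsilon)$ and $C_\psi=c_d\,\psi^{-4/3}$. Then there exists a graph $G$ with vertex set $P$ with at most $c_d\,\frac{C_\varepsilon}{\psi^{4/3}}\,n\log n$ edges such that, for $H\sim\mathcal D(G,\psi)$, the expected number of pairs $\{u,v\}\subseteq P$ that are not connected in $H$ by a path with at most $4$ edges and of total length at most $(1+\varepsilon)\|u-v\|$ is at most $c_d\,C_\varepsilon C_\psi\,n$.
   Context: The length of an edge $xy$ of a graph on a point set in $\mathbb R^d$ is the Euclidean distance $\|x-y\|$, and the length of a path is the sum of its edge lengths. For a graph $G$ and $\psi\in(0,1)$, $\mathcal D(G,\psi)$ is the distribution of the random subgraph of $G$ (same vertex set) in which each edge of $G$ is kept independently with probability $\psi$. *)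

theory Defs
  imports "HOL-Analysis.Analysis" "HOL-Probability.Probability" "HOL-Probability.Product_PMF"
begin

text \<open>An undirected graph is a pair of a vertex set and a set of two-element vertex sets.\<close>

type_synonym 'a ugraph = "'a set \<times> 'a set set"

abbreviation verts :: "'a ugraph \<Rightarrow> 'a set" where
  "verts \<equiv> fst"

abbreviation edges :: "'a ugraph \<Rightarrow> 'a set set" where
  "edges \<equiv> snd"

definition finite_simple_graph :: "'a ugraph \<Rightarrow> bool" where
  "finite_simple_graph G \<longleftrightarrow>
     finite (verts G) \<and> (\<forall>e\<in>edges G. e \<subseteq> verts G \<and> card e = 2)"

text \<open>A path is given by its list of vertices, so it has one edge fewer than list elements.\<close>

definition is_path :: "'a ugraph \<Rightarrow> 'a list \<Rightarrow> bool" where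
  "is_path G p \<longleftrightarrow>
     p \<noteq> [] \<and> distinct p \<and> set p \<subseteq> verts G \<and>
     (\<forall>i. Suc i < length p \<longrightarrow> {p ! i, p ! Suc i} \<in> edges G)"

definition num_edges :: "'a list \<Rightarrow> nat" where
  "num_edges p = length p - 1"

definition path_length :: "'a::metric_space list \<Rightarrow> real" where
  "path_length p = (\<Sum>i<num_edges p. dist (p ! i) (p ! Suc i))"

definition short_connected :: "'a::metric_space ugraph \<Rightarrow> nat \<Rightarrow> real \<Rightarrow> 'a \<Rightarrow> 'a \<Rightarrow> bool" where
  "short_connected G k \<epsilon> u v \<longleftrightarrow>
     (\<exists>p. is_path G p \<and> hd p = u \<and> last p = v \<and>
          num_edges p \<le> k \<and> path_length p \<le> (1 + \<epsilon>) * dist u v)"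

definition bad_pairs :: "'a::metric_space ugraph \<Rightarrow> nat \<Rightarrow> real \<Rightarrow> 'a set set" where
  "bad_pairs G k \<epsilon> =
     {{u, v} | u v. u \<in> verts G \<and> v \<in> verts G \<and> u \<noteq> v \<and> \<not> short_connected G k \<epsilon> u v}"

text \<open>The distribution \<open>\<D>(G,\<psi>)\<close>: an independent coin with success probability \<open>\<psi>\<close>
  decides for each edge whether it is kept. The library's product of distributions needs
  the edge set to be finite, as it is for a finite simple graph.\<close>

definition random_subgraph :: "'a ugraph \<Rightarrow> real \<Rightarrow> 'a ugraph pmf" where
  "random_subgraph G \<psi> =
     map_pmf (\<lambda>keep. (verts G, {e \<in> edges G. keep e}))
       (Pi_pmf (edges G) False (\<lambda>_. bernoulli_pmf \<psi>))"

end

theory Submission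
  imports Defs
begin

text \<open>
  Points are ordered in \<open>O(\<epsilon>\<^sup>-\<^sup>d log (1/\<epsilon>))\<close> ways such that for all \<open>u \<noteq> v\<close> some order has, between
  \<open>u\<close> and \<open>v\<close>, first only points near \<open>u\<close> and then only points near \<open>v\<close> (near: within
  \<open>\<epsilon>\<close>/6 times their distance). A path that is monotone in this order crosses from the points
  near \<open>u\<close> to the points near \<open>v\<close> only once, hence has length at most \<open>(1 + \<epsilon>) dist u v\<close>. The
  orders are traversals of grid hierarchies with ratio \<open>R \<approx> d/\<epsilon>\<close> between levels, shifted by 0 or
  1/3 in each coordinate, in which two prescribed children of a cell are visited consecutively.

  For one order let \<open>K \<approx> 8 \<psi>\<^sup>-\<^sup>4\<^sup>/\<^sup>3\<close>. Every point is joined to its \<open>K log n\<close> neighbours in the order,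
  and, for every \<open>k \<le> log n\<close>, to the first \<open>K\<close> points of all nearby blocks of length \<open>K 2\<^sup>k\<close>. If \<open>u\<close> and
  \<open>v\<close> have rank difference about \<open>4 K 2\<^sup>k\<close>, there are paths \<open>u, a, x, b, v\<close> where \<open>a\<close> and \<open>b\<close>
  range over the nearest \<open>K (k+1)\<close> successors of \<open>u\<close> and predecessors of \<open>v\<close>, and \<open>x\<close> over the first
  \<open>K\<close> points of a block in between. Conditioned on the edges at \<open>u\<close> and \<open>v\<close>, the events for
  different \<open>x\<close> are independent, and all of these paths fail with probability at most
  \<open>3/4\<^sup>k\<^sup>+\<^sup>1\<close>. This is quadratically small in the rank difference, so it sums to \<open>O(K)\<close> per point.
\<close>

section \<open>Independence of coin flips\<close>

text \<open>This is measurability with respect to the coordinates in \<open>A\<close>, phrased for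
  functions. It is the form in which events over disjoint sets of edges are recognised as
  independent.\<close>

definition determined_by :: "'e set \<Rightarrow> (('e \<Rightarrow> 'v) \<Rightarrow> 'b) \<Rightarrow> bool" where
  "determined_by A Y \<longleftrightarrow> (\<forall>f g. (\<forall>e\<in>A. f e = g e) \<longrightarrow> Y f = Y g)"

lemma determined_byI: "(\<And>f g. (\<And>e. e \<in> A \<Longrightarrow> f e = g e) \<Longrightarrow> Y f = Y g) \<Longrightarrow> determined_by A Y"
  unfolding determined_by_def by blast

lemma determined_byD: "determined_by A Y \<Longrightarrow> (\<And>e. e \<in> A \<Longrightarrow> f e = g e) \<Longrightarrow> Y f = Y g"
  unfolding determined_by_def by blast

lemma determined_by_const [simp]: "determined_by A (\<lambda>_. c)"
  by (simp add: determined_by_def)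

lemma determined_by_comp: "determined_by A Y \<Longrightarrow> determined_by A (\<lambda>f. h (Y f))"
  unfolding determined_by_def by metis

text \<open>Both factors are cut down to the supports, which are countable, so that the product rule
  for countable sets applies.\<close>

lemma measure_pair_pmf_Times:
  "measure_pmf.prob (pair_pmf M N) (A \<times> B) = measure_pmf.prob M A * measure_pmf.prob N B"
proof -
  have "measure_pmf.prob (pair_pmf M N) (A \<times> B)
      = measure_pmf.prob (pair_pmf M N) ((A \<inter> set_pmf M) \<times> (B \<inter> set_pmf N))"
    by (subst (1 2) measure_Int_set_pmf [symmetric]) (auto intro!: arg_cong2 [where f = measure])
  also have "\<dots> = measure_pmf.prob M (A \<inter> set_pmf M) * measure_pmf.prob N (B \<inter> set_pmf N)"
    by (rule measure_pmf_prob_product) auto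
  finally show ?thesis
    by (simp add: measure_Int_set_pmf)
qed

text \<open>\<open>Pi_pmf F\<close> is the image of the pair of \<open>Pi_pmf A\<close> and
  \<open>Pi_pmf (F - A)\<close> under gluing, and the preimage of the joint event is a
  rectangle.\<close>

lemma prob_Pi_pmf_split:
  assumes "finite F" "A \<subseteq> F" and Q: "determined_by A Q" and R: "determined_by (F - A) R"
  shows "measure_pmf.prob (Pi_pmf F d p) {f. Q f \<and> R f}
    = measure_pmf.prob (Pi_pmf A d p) {f. Q f} * measure_pmf.prob (Pi_pmf (F - A) d p) {f. R f}"
proof -
  have F: "F = A \<union> (F - A)" using assms by auto
  have fA: "finite A" using assms finite_subset by auto
  have *: "Pi_pmf F d p = map_pmf (\<lambda>(f,g) x. if x \<in> A then f x else g x)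
             (pair_pmf (Pi_pmf A d p) (Pi_pmf (F - A) d p))"
    by (subst F, rule Pi_pmf_union) (use fA assms in auto)
  have **: "(\<lambda>(f,g) x. if x \<in> A then f x else g x) -` {f. Q f \<and> R f} = {f. Q f} \<times> {f. R f}"
  proof -
    have "Q (\<lambda>x. if x \<in> A then f x else g x) = Q f"
      and "R (\<lambda>x. if x \<in> A then f x else g x) = R g" for f g
      by (rule determined_byD[OF Q], simp) (rule determined_byD[OF R], simp)
    thus ?thesis by auto
  qed
  show ?thesis
    unfolding * measure_map_pmf ** measure_pair_pmf_Times ..
qed

text \<open>The splitting is used three times: for both events together, and with either event
  replaced by \<open>True\<close>, which identifies the two factors as probabilities over all of
  \<open>F\<close>.\<close>

lemma prob_Pi_pmf_indep:
  assumes "finite F" "A \<subseteq> F" "B \<subseteq> F" "A \<inter> B = {}"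
    and Q: "determined_by A Q" and R: "determined_by B R"
  shows "measure_pmf.prob (Pi_pmf F d p) {f. Q f \<and> R f}
    = measure_pmf.prob (Pi_pmf F d p) {f. Q f} * measure_pmf.prob (Pi_pmf F d p) {f. R f}"
proof -
  have R': "determined_by (F - A) R"
    using R assms(3,4) unfolding determined_by_def by (metis DiffI disjoint_iff subsetD)
  show ?thesis
    using prob_Pi_pmf_split[OF assms(1,2) Q R', of d p]
      prob_Pi_pmf_split[OF assms(1,2) Q, of "\<lambda>_. True" d p]
      prob_Pi_pmf_split[OF assms(1,2) _ R', of "\<lambda>_. True" d p]
    by simp
qed

lemma prob_Pi_pmf_indep_family:
  fixes p :: "'e \<Rightarrow> 'v pmf"
  assumes "finite X" "finite F" "\<And>x. x \<in> X \<Longrightarrow> B x \<subseteq> F" "disjoint_family_on B X"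
    and "\<And>x. x \<in> X \<Longrightarrow> determined_by (B x) (Q x)"
  shows "measure_pmf.prob (Pi_pmf F d p) {f. \<forall>x\<in>X. Q x f}
    = (\<Prod>x\<in>X. measure_pmf.prob (Pi_pmf F d p) {f. Q x f})"
  using assms(1,3,4,5)
proof (induction rule: finite_induct)
  case (insert x X)
  have D: "determined_by (\<Union>y\<in>X. B y) (\<lambda>f. \<forall>y\<in>X. Q y f)"
  proof (rule determined_byI)
    fix f g :: "'e \<Rightarrow> 'v" assume fg: "\<And>e. e \<in> (\<Union>y\<in>X. B y) \<Longrightarrow> f e = g e"
    have "Q y f = Q y g" if "y \<in> X" for y
      using insert.prems(3)[of y] that by (intro determined_byD[of "B y" "Q y"] fg) auto
    thus "(\<forall>y\<in>X. Q y f) = (\<forall>y\<in>X. Q y g)" by auto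
  qed
  have disj: "B x \<inter> (\<Union>y\<in>X. B y) = {}"
    using insert.prems(2) insert.hyps by (auto simp: disjoint_family_on_def)
  have "measure_pmf.prob (Pi_pmf F d p) {f. \<forall>x\<in>insert x X. Q x f}
     = measure_pmf.prob (Pi_pmf F d p) {f. Q x f \<and> (\<forall>y\<in>X. Q y f)}"
    by simp
  also have "\<dots> = measure_pmf.prob (Pi_pmf F d p) {f. Q x f}
      * measure_pmf.prob (Pi_pmf F d p) {f. \<forall>y\<in>X. Q y f}"
    using insert.prems by (intro prob_Pi_pmf_indep[OF assms(2) _ _ disj _ D]) auto
  also have "measure_pmf.prob (Pi_pmf F d p) {f. \<forall>y\<in>X. Q y f}
      = (\<Prod>x\<in>X. measure_pmf.prob (Pi_pmf F d p) {f. Q x f})"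
    using insert.prems by (intro insert.IH) (auto simp: disjoint_family_on_def)
  finally show ?case using insert.hyps by simp
qed simp

text \<open>Conditioning on \<open>Y\<close> in elementary form: for a fixed value \<open>y\<close>
  the event \<open>R y\<close> is independent of \<open>Y f = y\<close>, and the events
  \<open>Y f = y\<close> are disjoint, so their probabilities sum to at most 1.\<close>

lemma prob_Pi_pmf_conditioning:
  assumes "finite F" "A \<subseteq> F" "B \<subseteq> F" "A \<inter> B = {}" "finite S"
    and Y: "determined_by A Y" and R: "\<And>y. y \<in> S \<Longrightarrow> determined_by B (R y)"
    and le: "\<And>y. y \<in> S \<Longrightarrow> measure_pmf.prob (Pi_pmf F d p) {f. R y f} \<le> \<beta>"
    and "\<beta> \<ge> 0"
  shows "measure_pmf.prob (Pi_pmf F d p) {f. Y f \<in> S \<and> R (Y f) f} \<le> \<beta>"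
proof -
  let ?P = "measure_pmf.prob (Pi_pmf F d p)"
  have "{f. Y f \<in> S \<and> R (Y f) f} = (\<Union>y\<in>S. {f. Y f = y \<and> R y f})" by auto
  hence "?P {f. Y f \<in> S \<and> R (Y f) f} \<le> (\<Sum>y\<in>S. ?P {f. Y f = y \<and> R y f})"
    using measure_pmf.finite_measure_subadditive_finite[OF assms(5)] by simp
  also have "\<dots> = (\<Sum>y\<in>S. ?P {f. Y f = y} * ?P {f. R y f})"
    by (intro sum.cong refl prob_Pi_pmf_indep[OF assms(1-4)]
      determined_by_comp[OF Y] R)
  also have "\<dots> \<le> (\<Sum>y\<in>S. ?P {f. Y f = y} * \<beta>)"
    by (intro sum_mono mult_left_mono le) auto
  also have "\<dots> = ?P (\<Union>y\<in>S. {f. Y f = y}) * \<beta>"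
    by (subst measure_pmf.finite_measure_finite_Union[OF assms(5)])
       (auto simp: disjoint_family_on_def sum_distrib_right)
  also have "\<dots> \<le> 1 * \<beta>"
    using \<open>\<beta> \<ge> 0\<close> by (intro mult_right_mono) auto
  finally show ?thesis by simp
qed

lemma prob_coins_all_False:
  assumes "finite F" "A \<subseteq> F" "0 \<le> \<psi>" "\<psi> \<le> 1"
  shows "measure_pmf.prob (Pi_pmf F False (\<lambda>_. bernoulli_pmf \<psi>)) {f. \<forall>e\<in>A. \<not> f e} = (1 - \<psi>) ^ card A"
proof -
  have "{f. \<forall>e\<in>A. \<not> f e} = Pi F (\<lambda>e. if e \<in> A then {False} else UNIV)"
    using assms by (auto simp: Pi_def)
  hence "measure_pmf.prob (Pi_pmf F False (\<lambda>_. bernoulli_pmf \<psi>)) {f. \<forall>e\<in>A. \<not> f e}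
      = (\<Prod>e\<in>F. measure_pmf.prob (bernoulli_pmf \<psi>) (if e \<in> A then {False} else UNIV))"
    using assms by (simp add: measure_Pi_pmf_Pi)
  also have "\<dots> = (\<Prod>e\<in>A. 1 - \<psi>)"
    using assms by (intro prod.mono_neutral_cong_right) (auto simp: measure_pmf_single)
  finally show ?thesis by simp
qed

text \<open>A lower-tail Chernoff bound for a threshold of at most a quarter of the mean: Markov's
  inequality is applied to 2 to the power minus the number of kept edges, a product of independent
  factors with expectation \<open>(1 - \<psi> / 2) ^ card A\<close>.\<close>

lemma prob_few_coins:
  assumes "finite F" "A \<subseteq> F" "0 \<le> \<psi>" "\<psi> \<le> 1"
    and "0 \<le> m" and m: "2 * m \<le> \<psi> * real (card A) / 2"
  shows "measure_pmf.prob (Pi_pmf F False (\<lambda>_. bernoulli_pmf \<psi>)) {f. real (card {e\<in>A. f e}) < m} \<le> exp (- m)"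
proof -
  let ?p = "Pi_pmf F False (\<lambda>_. bernoulli_pmf \<psi>)"
  have fA: "finite A" using assms finite_subset by auto
  define h where "h = (\<lambda>e b. if e \<in> A \<and> b then 1 / 2 else (1 :: real))"
  have h: "(\<Prod>e\<in>F. h e (f e)) = (1 / 2) ^ card {e\<in>A. f e}" for f
  proof -
    have "(\<Prod>e\<in>F. h e (f e)) = (\<Prod>e\<in>{e\<in>A. f e}. 1 / 2)"
      using assms by (intro prod.mono_neutral_cong_right) (auto simp: h_def)
    thus ?thesis by simp
  qed
  have E: "measure_pmf.expectation ?p (\<lambda>f. \<Prod>e\<in>F. h e (f e)) = (1 - \<psi> / 2) ^ card A"
  proof -
    have "measure_pmf.expectation ?p (\<lambda>f. \<Prod>e\<in>F. h e (f e))
      = (\<Prod>e\<in>F. measure_pmf.expectation (bernoulli_pmf \<psi>) (h e))"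
      using assms by (intro expectation_prod_Pi_pmf)
        (auto simp: h_def intro!: integrable_measure_pmf_finite)
    also have "\<dots> = (\<Prod>e\<in>F. if e \<in> A then 1 - \<psi> / 2 else 1)"
      using assms by (intro prod.cong) (auto simp: h_def)
    also have "\<dots> = (\<Prod>e\<in>A. 1 - \<psi> / 2)"
      using assms by (intro prod.mono_neutral_cong_right) auto
    finally show ?thesis by simp
  qed
  have fin: "finite (set_pmf ?p)"
    using assms(1) by (subst set_Pi_pmf) auto
  have "measure_pmf.prob ?p {f. real (card {e\<in>A. f e}) < m}
     \<le> measure_pmf.prob ?p {f. (\<Prod>e\<in>F. h e (f e)) \<ge> (1 / 2) powr m}"
    by (intro measure_pmf.finite_measure_mono)
       (auto simp: h powr_realpow [symmetric] intro!: powr_mono')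
  also have "\<dots> \<le> measure_pmf.expectation ?p (\<lambda>f. \<Prod>e\<in>F. h e (f e)) / (1 / 2) powr m"
  proof -
    have "integrable ?p (\<lambda>f. \<Prod>e\<in>F. h e (f e))"
      using fin by (rule integrable_measure_pmf_finite)
    moreover have "AE f in ?p. 0 \<le> (\<Prod>e\<in>F. h e (f e))"
      by (intro AE_I2 prod_nonneg) (auto simp: h_def)
    ultimately show ?thesis
      using integral_Markov_inequality_measure [of ?p "\<lambda>f. \<Prod>e\<in>F. h e (f e)" "{}" "(1/2) powr m"]
      by simp
  qed
  also have "\<dots> = 2 powr m * (1 - \<psi> / 2) ^ card A"
    by (simp add: E powr_divide field_simps)
  also have "\<dots> \<le> exp m * exp (- \<psi> * real (card A) / 2)"
  proof -
    have "(1 - \<psi> / 2) ^ card A \<le> exp (- (\<psi> / 2)) ^ card A"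
      using assms exp_ge_add_one_self [of "- (\<psi> / 2)"] by (intro power_mono) auto
    also have "\<dots> = exp (- \<psi> * real (card A) / 2)"
      by (simp add: exp_of_nat_mult [symmetric] field_simps)
    finally show ?thesis
      using \<open>0 \<le> m\<close> ln_2_less_1 assms by (intro mult_mono zero_le_power) (auto simp: powr_def mult_left_le)
  qed
  also have "\<dots> \<le> exp (- m)"
    using m by (simp add: mult_exp_exp)
  finally show ?thesis .
qed

section \<open>Four-edge paths through three layers\<close>

text \<open>Here \<open>y\<close> is the probability that a middle vertex has no surviving edge to
  one side, and the left-hand side is the probability that it fails on at least one of two sides.
  For small \<open>z\<close> each side succeeds with probability at least \<open>z / 2\<close>; for
  large \<open>z\<close> the union bound \<open>2 * y\<close> is good enough.\<close>

lemma one_minus_square_le_exp: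
  fixes y z :: real
  assumes "0 \<le> y" "y \<le> exp (- z)" "0 \<le> z"
  shows "1 - (1 - y)^2 \<le> exp (- min (z^2 / 4) (3 / 10 * z))"
proof (cases "z \<le> 1")
  case True
  have "exp (- z) \<le> 1 - z / 2"
  proof -
    have "1 + z \<le> exp z" using exp_ge_add_one_self by blast
    moreover have "1 \<le> (1 - z / 2) * (1 + z)"
      using True assms mult_nonneg_nonneg[of z "1 - z"] by (simp add: algebra_simps)
    moreover have "(1 - z / 2) * (1 + z) \<le> (1 - z / 2) * exp z"
      using calculation True by (intro mult_left_mono) auto
    ultimately have "1 \<le> (1 - z / 2) * exp z" by linarith
    thus ?thesis by (simp add: exp_minus field_simps)
  qed
  hence "(z / 2)^2 \<le> (1 - y)^2"
    using assms by (intro power_mono) auto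
  hence "1 - (1 - y)^2 \<le> 1 + - (z^2 / 4)" by (simp add: power2_eq_square)
  also have "\<dots> \<le> exp (- (z^2 / 4))" by (rule exp_ge_add_one_self)
  also have "\<dots> \<le> exp (- min (z^2 / 4) (3 / 10 * z))" by simp
  finally show ?thesis .
next
  case False
  have "1 - (1 - y)^2 \<le> 2 * y" by (simp add: power2_eq_square algebra_simps)
  also have "\<dots> \<le> exp (ln 2) * exp (- z)" using assms by simp
  also have "\<dots> = exp (ln 2 - z)" by (simp add: exp_diff exp_minus field_simps)
  \<comment> \<open>Since \<open>ln 2\<close> is at most 25/36 < 7/10 and \<open>z > 1\<close>, the
    summand \<open>ln 2\<close> costs at most 7/10 of \<open>z\<close>.\<close>
  also have "\<dots> \<le> exp (- (3 / 10 * z))"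
    using False ln2_le_25_over_36 by simp
  also have "\<dots> \<le> exp (- min (z^2 / 4) (3 / 10 * z))" by simp
  finally show ?thesis .
qed

lemma exp_minus_two_mult_le: "exp (- (2 * real n)) \<le> 1 / 4 ^ n"
proof -
  have "(2::real) \<le> exp 1" using exp_ge_add_one_self[of "1::real"] by simp
  hence "(2::real) ^ (2 * n) \<le> exp 1 ^ (2 * n)" by (intro power_mono) auto
  hence "(4::real) ^ n \<le> exp (2 * real n)"
    by (simp add: power_mult flip: exp_of_nat_mult) (simp add: mult.commute)
  thus ?thesis by (simp add: exp_minus field_simps)
qed

text \<open>The two terms of the minimum decide the cases \<open>\<psi> m \<le> 1\<close> and \<open>\<psi> m > 1\<close>;
  the former is where the exponent 4/3 is needed.\<close>

lemma hop_parameters: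
  fixes \<psi> :: real and K \<kappa> :: nat
  assumes "0 < \<psi>" "\<psi> < 1" "8 * \<psi> powr (- 4 / 3) \<le> real K" "1 \<le> \<kappa>"
  defines "m \<equiv> \<psi> * real (K * \<kappa>) / 4"
  shows "2 * real \<kappa> \<le> m"
    and "2 * real \<kappa> \<le> real K * min ((\<psi> * m)^2 / 4) (3 / 10 * (\<psi> * m))"
proof -
  \<comment> \<open>With \<open>\<psi> = t ^ 3\<close> all exponents become integers, and the
    hypothesis on \<open>K\<close> reads \<open>8 \<le> K * t ^ 4\<close>.\<close>
  define t where "t = \<psi> powr (1 / 3)"
  have t: "0 < t" "t \<le> 1" using assms by (auto simp: t_def intro!: powr_le1)
  have \<psi>: "\<psi> = t ^ 3" using assms by (simp add: t_def powr_powr flip: powr_realpow)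
  have "\<psi> powr (- 4 / 3) * t ^ 4 = 1"
    using assms by (simp add: t_def powr_powr flip: powr_realpow powr_add)
  hence K: "8 \<le> real K * t ^ 4"
    using mult_right_mono[OF assms(3), of "t ^ 4"] t by (simp add: mult.assoc)
  have \<kappa>: "1 \<le> real \<kappa>" using assms by simp
  have "8 \<le> real K * t ^ 3"
    using K mult_left_mono[of "t ^ 4" "t ^ 3" "real K"] power_decreasing[of 3 4 t] t by simp
  hence "8 * real \<kappa> \<le> (real K * t ^ 3) * real \<kappa>" using \<kappa> by (intro mult_right_mono) auto
  thus "2 * real \<kappa> \<le> m" by (simp add: m_def \<psi> mult_ac)
  have "8 ^ 2 \<le> (real K * t ^ 4) ^ 2" using K by (intro power_mono) auto
  also have "\<dots> = (real K) ^ 2 * t ^ 8" by (simp add: power_mult_distrib flip: power_mult)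
  also have "\<dots> \<le> (real K) ^ 2 * t ^ 6"
    using t by (intro mult_left_mono power_decreasing) auto
  finally have "64 * real \<kappa> \<le> ((real K) ^ 2 * t ^ 6) * real \<kappa>"
    using \<kappa> by (intro mult_right_mono) auto
  moreover have "real K * (3 / 10 * (\<psi> * m)) = 3 / 40 * ((real K) ^ 2 * t ^ 6 * real \<kappa>)"
    by (simp add: m_def \<psi> power2_eq_square eval_nat_numeral)
  ultimately have 1: "2 * real \<kappa> \<le> real K * (3 / 10 * (\<psi> * m))" using \<kappa> by linarith
  \<comment> \<open>\<open>K * (\<psi> * m)^2\<close> is a constant times
    \<open>(K * t ^ 4) ^ 3 * \<kappa>^2\<close>, with no power of \<open>t\<close> left
    over.\<close>
  have "8 ^ 3 \<le> (real K * t ^ 4) ^ 3" using K by (intro power_mono) auto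
  also have "\<dots> = (real K) ^ 3 * t ^ 12" by (simp add: power_mult_distrib flip: power_mult)
  finally have "512 * (real \<kappa>)^2 \<le> ((real K) ^ 3 * t ^ 12) * (real \<kappa>)^2"
    by (intro mult_right_mono) auto
  moreover have "real K * ((\<psi> * m)^2 / 4) = 1 / 64 * ((real K) ^ 3 * t ^ 12 * (real \<kappa>)^2)"
    by (simp add: m_def \<psi> eval_nat_numeral)
  moreover have "real \<kappa> \<le> (real \<kappa>)^2" using \<kappa> by (simp add: power2_eq_square)
  ultimately have "2 * real \<kappa> \<le> real K * ((\<psi> * m)^2 / 4)" using \<kappa> by linarith
  with 1 show "2 * real \<kappa> \<le> real K * min ((\<psi> * m)^2 / 4) (3 / 10 * (\<psi> * m))"
    by (simp add: min_def)
qed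

text \<open>There are three ways to fail, each of probability at most
  \<open>1 / 4 ^ \<kappa>\<close>: fewer than \<open>m\<close> edges survive from \<open>i\<close>
  to \<open>A\<close>, fewer than \<open>m\<close> from \<open>B\<close> to \<open>j\<close>, or
  there are enough but no middle vertex joins the surviving parts of \<open>A\<close> and
  \<open>B\<close>. The threshold \<open>m\<close> is a quarter of the expected number of surviving
  edges.\<close>

lemma prob_four_hop_failure:
  fixes i j :: 'a and A B X :: "'a set" and F :: "'a set set"
  assumes F: "finite F" and \<psi>: "0 < \<psi>" "\<psi> < 1"
    and fin: "finite A" "finite B" "finite X"
    and notin: "i \<notin> A" "i \<notin> X" "i \<notin> B" "j \<notin> A" "j \<notin> X" "j \<notin> B"
    and disj: "A \<inter> X = {}" "A \<inter> B = {}" "X \<inter> B = {}" "i \<noteq> j"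
    and edges: "\<And>a. a \<in> A \<Longrightarrow> {i, a} \<in> F" "\<And>a x. a \<in> A \<Longrightarrow> x \<in> X \<Longrightarrow> {a, x} \<in> F"
      "\<And>x b. x \<in> X \<Longrightarrow> b \<in> B \<Longrightarrow> {x, b} \<in> F" "\<And>b. b \<in> B \<Longrightarrow> {b, j} \<in> F"
    and card: "card A = K * \<kappa>" "card B = K * \<kappa>" "card X = K"
    and K: "8 * \<psi> powr (- 4 / 3) \<le> real K" and \<kappa>: "1 \<le> \<kappa>"
  shows "measure_pmf.prob (Pi_pmf F False (\<lambda>_. bernoulli_pmf \<psi>))
      {f. \<not> (\<exists>a\<in>A. \<exists>x\<in>X. \<exists>b\<in>B. f {i, a} \<and> f {a, x} \<and> f {x, b} \<and> f {b, j})} \<le> 3 / 4 ^ \<kappa>"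
proof -
  let ?P = "measure_pmf.prob (Pi_pmf F False (\<lambda>_. bernoulli_pmf \<psi>))"
  define m where "m = \<psi> * real (K * \<kappa>) / 4"
  note par = hop_parameters [OF \<psi> K \<kappa>, folded m_def]
  have m0: "0 \<le> m" using \<psi> by (simp add: m_def)
  have em: "exp (- m) \<le> 1 / 4 ^ \<kappa>"
    using par(1) exp_minus_two_mult_le [of \<kappa>] by (smt (verit) exp_less_mono)
  \<comment> \<open>\<open>Y\<close> is what the edges at \<open>i\<close> and \<open>j\<close>
    reveal, \<open>S\<close> the set of its good values, and \<open>R\<close> the failure of every
    middle vertex for given surviving sets. \<open>E1\<close> and \<open>E2 x\<close> are the edges
    on which \<open>Y\<close> and the event at \<open>x\<close> depend.\<close>
  define Y where "Y = (\<lambda>f::'a set \<Rightarrow> bool. ({a\<in>A. f {i, a}}, {b\<in>B. f {b, j}}))"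
  define R where "R = (\<lambda>(A', B') (f :: 'a set \<Rightarrow> bool).
      \<forall>x\<in>X. \<not> ((\<exists>a\<in>A'. f {a, x}) \<and> (\<exists>b\<in>B'. f {x, b})))"
  define S where "S = {(A', B'). A' \<subseteq> A \<and> B' \<subseteq> B \<and> m \<le> real (card A') \<and> m \<le> real (card B')}"
  define E1 where "E1 = (\<lambda>a. {i, a}) ` A \<union> (\<lambda>b. {b, j}) ` B"
  define E2 where "E2 = (\<lambda>x. (\<lambda>a. {a, x}) ` A \<union> (\<lambda>b. {x, b}) ` B)"

  have few: "?P {f. real (card {a\<in>A. f (e a)}) < m} \<le> exp (- m)"
    if "inj_on e A" "e ` A \<subseteq> F" "finite A" "card A = K * \<kappa>" for e :: "'a \<Rightarrow> 'a set" and A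
  proof -
    have "card {a\<in>A. f (e a)} = card {d\<in>e ` A. f d}" for f
      using that(1) by (intro bij_betw_same_card [of e]) (auto simp: bij_betw_def inj_on_def)
    thus ?thesis
      using prob_few_coins [OF F that(2), of \<psi> m] \<psi> that m0 by (simp add: card_image m_def)
  qed
  have few1: "?P {f. real (card {a\<in>A. f {i, a}}) < m} \<le> exp (- m)"
    using edges(1) fin card notin
    by (intro few) (auto simp: inj_on_def doubleton_eq_iff)
  have few2: "?P {f. real (card {b\<in>B. f {b, j}}) < m} \<le> exp (- m)"
    using edges(4) fin card notin
    by (intro few) (auto simp: inj_on_def doubleton_eq_iff)

  have fixed: "?P {f. R y f} \<le> 1 / 4 ^ \<kappa>" if "y \<in> S" for y
  proof -
    obtain A' B' where y: "y = (A', B')" by force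
    have A': "A' \<subseteq> A" "m \<le> real (card A')" and B': "B' \<subseteq> B" "m \<le> real (card B')"
      using that by (auto simp: S_def y)
    have fin': "finite A'" "finite B'" using A' B' fin finite_subset by auto
    have "{f. R y f} = {f. \<forall>x\<in>X. \<not> ((\<exists>a\<in>A'. f {a, x}) \<and> (\<exists>b\<in>B'. f {x, b}))}"
      by (simp add: R_def y)
    also have "?P \<dots> = (\<Prod>x\<in>X. ?P {f. \<not> ((\<exists>a\<in>A'. f {a, x}) \<and> (\<exists>b\<in>B'. f {x, b}))})"
    \<comment> \<open>Each edge between \<open>X\<close> and \<open>A\<close> or \<open>B\<close>
      has exactly one end in \<open>X\<close>, so different middle vertices use disjoint sets of
      edges.\<close>
    proof (rule prob_Pi_pmf_indep_family [where B = E2])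
      show "disjoint_family_on E2 X"
        using disj by (auto simp: disjoint_family_on_def E2_def doubleton_eq_iff)
      show "determined_by (E2 x) (\<lambda>f. \<not> ((\<exists>a\<in>A'. f {a, x}) \<and> (\<exists>b\<in>B'. f {x, b})))" for x
      proof (rule determined_byI)
        fix f g :: "'a set \<Rightarrow> bool" assume fg: "\<And>e. e \<in> E2 x \<Longrightarrow> f e = g e"
        have "f {a, x} = g {a, x}" if "a \<in> A'" for a using that A' by (intro fg) (auto simp: E2_def)
        moreover have "f {x, b} = g {x, b}" if "b \<in> B'" for b using that B' by (intro fg) (auto simp: E2_def)
        ultimately show "(\<not> ((\<exists>a\<in>A'. f {a, x}) \<and> (\<exists>b\<in>B'. f {x, b})))
          = (\<not> ((\<exists>a\<in>A'. g {a, x}) \<and> (\<exists>b\<in>B'. g {x, b})))" by simp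
      qed
    qed (use F fin edges in \<open>auto simp: E2_def\<close>)
    also have "\<dots> \<le> (\<Prod>x\<in>X. exp (- min ((\<psi> * m)^2 / 4) (3 / 10 * (\<psi> * m))))"
    proof (intro prod_mono conjI measure_nonneg)
      fix x assume x: "x \<in> X"
      have few: "?P {f. \<forall>e\<in>D. \<not> f e} \<le> exp (- (\<psi> * m))" if "m \<le> real (card D)" "D \<subseteq> F" for D
      proof -
        have "?P {f. \<forall>e\<in>D. \<not> f e} = (1 - \<psi>) ^ card D"
          using F that \<psi> by (intro prob_coins_all_False) auto
        also have "\<dots> \<le> exp (- \<psi>) ^ card D"
          using exp_ge_add_one_self [of "- \<psi>"] \<psi> by (intro power_mono) auto
        also have "\<dots> = exp (- (\<psi> * real (card D)))"
          by (simp add: exp_of_nat_mult [symmetric] mult.commute)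
        also have "\<dots> \<le> exp (- (\<psi> * m))" using that \<psi> by simp
        finally show ?thesis .
      qed
      define D1 where "D1 = (\<lambda>a. {a, x}) ` A'"
      define D2 where "D2 = (\<lambda>b. {x, b}) ` B'"
      have D: "D1 \<subseteq> F" "D2 \<subseteq> F" "D1 \<inter> D2 = {}" "finite D1" "finite D2"
        using A'(1) B'(1) edges x disj fin' by (fastforce simp: D1_def D2_def doubleton_eq_iff)+
      have "card D1 = card A'" "card D2 = card B'"
        unfolding D1_def D2_def
        using A' B' x disj by (auto intro!: card_image simp: inj_on_def doubleton_eq_iff)
      hence le: "?P {f. \<forall>e\<in>D1. \<not> f e} \<le> exp (- (\<psi> * m))" "?P {f. \<forall>e\<in>D2. \<not> f e} \<le> exp (- (\<psi> * m))"
        using D A' B' by (auto intro!: few)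
      have compl: "?P {f. \<exists>e\<in>D. f e} = 1 - ?P {f. \<forall>e\<in>D. \<not> f e}" for D :: "'a set set"
        by (subst measure_pmf.prob_compl [symmetric]) (auto intro!: arg_cong2 [where f = measure])
      have "{f. \<not> ((\<exists>a\<in>A'. f {a, x}) \<and> (\<exists>b\<in>B'. f {x, b}))}
          = UNIV - {f. (\<exists>e\<in>D1. f e) \<and> (\<exists>e\<in>D2. f e)}"
        by (auto simp: D1_def D2_def)
      hence "?P {f. \<not> ((\<exists>a\<in>A'. f {a, x}) \<and> (\<exists>b\<in>B'. f {x, b}))}
          = 1 - ?P {f. (\<exists>e\<in>D1. f e) \<and> (\<exists>e\<in>D2. f e)}"
        using measure_pmf.prob_compl by simp
      also have "?P {f. (\<exists>e\<in>D1. f e) \<and> (\<exists>e\<in>D2. f e)} = ?P {f. \<exists>e\<in>D1. f e} * ?P {f. \<exists>e\<in>D2. f e}"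
        by (rule prob_Pi_pmf_indep [OF F D(1-3)]) (auto simp: determined_by_def)
      also have "1 - \<dots> \<le> 1 - (1 - exp (- (\<psi> * m)))^2"
        unfolding compl power2_eq_square using le m0 \<psi>
        by (intro diff_left_mono mult_mono) auto
      also have "\<dots> \<le> exp (- min ((\<psi> * m)^2 / 4) (3 / 10 * (\<psi> * m)))"
        using m0 \<psi> by (intro one_minus_square_le_exp) auto
      finally show "?P {f. \<not> ((\<exists>a\<in>A'. f {a, x}) \<and> (\<exists>b\<in>B'. f {x, b}))}
        \<le> exp (- min ((\<psi> * m)^2 / 4) (3 / 10 * (\<psi> * m)))" .
    qed
    also have "\<dots> = exp (- (real K * min ((\<psi> * m)^2 / 4) (3 / 10 * (\<psi> * m))))"
      by (simp add: card exp_of_nat_mult [symmetric])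
    also have "\<dots> \<le> exp (- (2 * real \<kappa>))" using par(2) by simp
    also have "\<dots> \<le> 1 / 4 ^ \<kappa>" by (rule exp_minus_two_mult_le)
    finally show ?thesis .
  qed

  have many: "?P {f. Y f \<in> S \<and> R (Y f) f} \<le> 1 / 4 ^ \<kappa>"
  proof (rule prob_Pi_pmf_conditioning [where A = E1 and B = "\<Union>x\<in>X. E2 x"])
    show "E1 \<inter> (\<Union>x\<in>X. E2 x) = {}"
      using notin disj by (auto simp: E1_def E2_def doubleton_eq_iff)
    show "finite S"
      by (rule finite_subset [of _ "Pow A \<times> Pow B"]) (use fin in \<open>auto simp: S_def\<close>)
    show "determined_by E1 Y"
      by (rule determined_byI) (auto simp: Y_def E1_def)
    show "determined_by (\<Union>x\<in>X. E2 x) (R y)" if "y \<in> S" for y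
    proof (rule determined_byI)
      fix f g :: "'a set \<Rightarrow> bool" assume fg: "\<And>e. e \<in> (\<Union>x\<in>X. E2 x) \<Longrightarrow> f e = g e"
      obtain A' B' where y: "y = (A', B')" "A' \<subseteq> A" "B' \<subseteq> B" using \<open>y \<in> S\<close> by (auto simp: S_def)
      have "f {a, x} = g {a, x}" if "a \<in> A'" "x \<in> X" for a x
        using that y by (intro fg UN_I [of x]) (auto simp: E2_def)
      moreover have "f {x, b} = g {x, b}" if "b \<in> B'" "x \<in> X" for b x
        using that y by (intro fg UN_I [of x]) (auto simp: E2_def)
      ultimately show "R y f = R y g" by (simp add: R_def y)
    qed
  qed (use F fin edges fixed in \<open>auto simp: E1_def E2_def\<close>)

  have "{f. \<not> (\<exists>a\<in>A. \<exists>x\<in>X. \<exists>b\<in>B. f {i, a} \<and> f {a, x} \<and> f {x, b} \<and> f {b, j})}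
    \<subseteq> {f. real (card {a\<in>A. f {i, a}}) < m} \<union> {f. real (card {b\<in>B. f {b, j}}) < m}
      \<union> {f. Y f \<in> S \<and> R (Y f) f}"
    by (auto simp: Y_def S_def R_def not_less)
  hence "?P {f. \<not> (\<exists>a\<in>A. \<exists>x\<in>X. \<exists>b\<in>B. f {i, a} \<and> f {a, x} \<and> f {x, b} \<and> f {b, j})}
    \<le> ?P ({f. real (card {a\<in>A. f {i, a}}) < m} \<union> {f. real (card {b\<in>B. f {b, j}}) < m}
      \<union> {f. Y f \<in> S \<and> R (Y f) f})"
    by (intro measure_pmf.finite_measure_mono) auto
  also have "\<dots> \<le> ?P {f. real (card {a\<in>A. f {i, a}}) < m} + ?P {f. real (card {b\<in>B. f {b, j}}) < m}
      + ?P {f. Y f \<in> S \<and> R (Y f) f}"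
    by (intro order.trans [OF measure_Un_le] add_mono measure_Un_le) auto
  also have "\<dots> \<le> 1 / 4 ^ \<kappa> + 1 / 4 ^ \<kappa> + 1 / 4 ^ \<kappa>"
    using few1 few2 many em by linarith
  finally show ?thesis by simp
qed

section \<open>The graph of a linear order\<close>

text \<open>Deliberately not symmetric: in the second case only \<open>x\<close> has to be a hub,
  one of the first \<open>K\<close> ranks of an aligned block of length \<open>K * 2 ^ k\<close>.
  The unordered pairs of \<open>order_edges\<close> restore symmetry.\<close>

definition line_adj :: "nat \<Rightarrow> nat \<Rightarrow> nat \<Rightarrow> nat \<Rightarrow> bool" where
  "line_adj K s x y \<longleftrightarrow>
     x \<le> y + K * Suc s \<and> y \<le> x + K * Suc s \<or>
     (\<exists>k\<le>s. x mod (K * 2 ^ k) < K \<and> x \<le> y + 8 * (K * 2 ^ k) \<and> y \<le> x + 8 * (K * 2 ^ k))"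

definition order_edges :: "nat \<Rightarrow> nat \<Rightarrow> 'a set \<Rightarrow> ('a \<Rightarrow> nat) \<Rightarrow> 'a set set" where
  "order_edges K s P \<sigma> = {{p, q} | p q. p \<in> P \<and> q \<in> P \<and> p \<noteq> q \<and> line_adj K s (\<sigma> p) (\<sigma> q)}"

lemma order_edgesI:
  assumes "p \<in> P" "q \<in> P" "p \<noteq> q" "line_adj K s (\<sigma> p) (\<sigma> q) \<or> line_adj K s (\<sigma> q) (\<sigma> p)"
  shows "{p, q} \<in> order_edges K s P \<sigma>"
  using assms unfolding order_edges_def by (auto simp: doubleton_eq_iff)

lemma card_le_image: "finite B \<Longrightarrow> A \<subseteq> f ` B \<Longrightarrow> card A \<le> card B"
  by (meson card_image_le card_mono finite_imageI le_trans)

text \<open>For fixed \<open>y\<close> there are at most \<open>3 * K * Suc s\<close> close ranks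
  \<open>x\<close>, and at each of the \<open>Suc s\<close> scales at most 17 blocks, from 8 before
  to 8 after that of \<open>y\<close>, with \<open>K\<close> hubs each; 3 + 17 = 20.\<close>

lemma card_line_adj_le:
  assumes "0 < K"
  shows "finite {(x, y). x < n \<and> y < n \<and> line_adj K s x y}" (is "finite ?A")
    and "card {(x, y). x < n \<and> y < n \<and> line_adj K s x y} \<le> 20 * n * K * Suc s"
proof -
  show "finite ?A" by (rule finite_subset [of _ "{..<n} \<times> {..<n}"]) auto
  define N where "N = {(x, y). y < n \<and> x \<le> y + K * Suc s \<and> y \<le> x + K * Suc s}"
  define M where "M = (\<lambda>k. {(x, y). y < n \<and> x mod (K * 2 ^ k) < K \<and>
      x \<le> y + 8 * (K * 2 ^ k) \<and> y \<le> x + 8 * (K * 2 ^ k)})"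
  have N: "N \<subseteq> (\<lambda>(y, e). (y + e - K * Suc s, y)) ` ({..<n} \<times> {..2 * (K * Suc s)})"
  proof
    fix z assume "z \<in> N"
    then obtain x y where z: "z = (x, y)" "y < n" "x \<le> y + K * Suc s" "y \<le> x + K * Suc s"
      by (auto simp: N_def)
    thus "z \<in> (\<lambda>(y, e). (y + e - K * Suc s, y)) ` ({..<n} \<times> {..2 * (K * Suc s)})"
      by (intro image_eqI [of _ _ "(y, x + K * Suc s - y)"]) auto
  qed
  have fN: "finite N" by (rule finite_subset [OF N]) auto
  have cN: "card N \<le> 3 * n * K * Suc s"
  proof -
    have "card N \<le> n * (2 * (K * Suc s) + 1)"
      using card_le_image [OF _ N] by simp
    also have "\<dots> \<le> n * (3 * (K * Suc s))" using assms by (intro mult_le_mono2) auto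
    finally show ?thesis by (simp only: mult_ac)
  qed
  \<comment> \<open>A hub is encoded by its block, relative to that of \<open>y\<close>, and its
    position in the block. The offset is shifted by 8 to remain a natural number.\<close>
  have M: "M k \<subseteq> (\<lambda>(y, e, r). ((y div (K * 2 ^ k) + e - 8) * (K * 2 ^ k) + r, y)) ` ({..<n} \<times> {..16} \<times> {..<K})" for k
  proof
    fix z assume "z \<in> M k"
    moreover define m where "m = K * 2 ^ k"
    ultimately obtain x y where z: "z = (x, y)" "y < n" "x mod m < K" "x \<le> y + 8 * m" "y \<le> x + 8 * m"
      by (auto simp: M_def)
    have m: "0 < m" using assms by (simp add: m_def)
    have "x div m \<le> y div m + 8" using div_le_mono [OF z(4), of m] m by simp
    moreover have "y div m \<le> x div m + 8" using div_le_mono [OF z(5), of m] m by simp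
    ultimately show "z \<in> (\<lambda>(y, e, r). ((y div (K * 2 ^ k) + e - 8) * (K * 2 ^ k) + r, y)) ` ({..<n} \<times> {..16} \<times> {..<K})"
      using z by (intro image_eqI [of _ _ "(y, x div m + 8 - y div m, x mod m)"]) (auto simp flip: m_def)
  qed
  have fM: "finite (M k)" for k by (rule finite_subset [OF M]) auto
  have cM: "card (M k) \<le> n * (17 * K)" for k
    using card_le_image [OF _ M] by (simp add: card_cartesian_product)
  have "?A \<subseteq> N \<union> (\<Union>k\<in>{..s}. M k)"
    by (auto simp: line_adj_def N_def M_def)
  hence "card ?A \<le> card (N \<union> (\<Union>k\<in>{..s}. M k))"
    using fN fM by (intro card_mono) auto
  also have "\<dots> \<le> card N + (\<Sum>k\<in>{..s}. card (M k))"
    by (intro order.trans [OF card_Un_le] add_mono order.refl card_UN_le) auto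
  also have "\<dots> \<le> 3 * n * K * Suc s + (\<Sum>k\<in>{..s}. n * (17 * K))"
    by (intro add_mono cN sum_mono cM)
  also have "\<dots> = 20 * n * K * Suc s" by (simp add: algebra_simps)
  finally show "card ?A \<le> 20 * n * K * Suc s" .
qed

lemma order_edges:
  assumes \<sigma>: "bij_betw \<sigma> P {..<n}" and "0 < K"
  shows "finite (order_edges K s P \<sigma>)" and "card (order_edges K s P \<sigma>) \<le> 20 * n * K * Suc s"
    and "e \<in> order_edges K s P \<sigma> \<Longrightarrow> e \<subseteq> P \<and> card e = 2"
proof -
  let ?A = "{(x, y). x < n \<and> y < n \<and> line_adj K s x y}"
  let ?\<tau> = "inv_into P \<sigma>"
  have \<tau>: "?\<tau> (\<sigma> p) = p" if "p \<in> P" for p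
    using that \<sigma> by (auto simp: bij_betw_def)
  have "order_edges K s P \<sigma> \<subseteq> (\<lambda>(x, y). {?\<tau> x, ?\<tau> y}) ` ?A"
  proof
    fix e assume "e \<in> order_edges K s P \<sigma>"
    then obtain p q where e: "e = {p, q}" "p \<in> P" "q \<in> P" "line_adj K s (\<sigma> p) (\<sigma> q)"
      by (auto simp: order_edges_def)
    thus "e \<in> (\<lambda>(x, y). {?\<tau> x, ?\<tau> y}) ` ?A"
      using \<sigma> \<tau> by (intro image_eqI [of _ _ "(\<sigma> p, \<sigma> q)"]) (auto simp: bij_betw_def)
  qed
  note * = this
  show "finite (order_edges K s P \<sigma>)"
    by (rule finite_subset [OF *]) (use card_line_adj_le [OF assms(2)] in auto)
  show "card (order_edges K s P \<sigma>) \<le> 20 * n * K * Suc s"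
    using card_le_image [OF _ *] card_line_adj_le [OF assms(2), of n s] by linarith
  show "e \<in> order_edges K s P \<sigma> \<Longrightarrow> e \<subseteq> P \<and> card e = 2"
    by (auto simp: order_edges_def)
qed

section \<open>Failure probabilities by rank difference\<close>

text \<open>Below \<open>4 * K\<close> the three layers need not fit between the two ranks, so only
  the trivial bound is used. The quadratic decay beyond makes the sum over all \<open>d\<close>
  converge.\<close>

definition failure_bound :: "nat \<Rightarrow> nat \<Rightarrow> real" where
  "failure_bound K d = (if d < 4 * K then 1 else 48 * (real K)^2 / (real d)^2)"

lemma failure_bound_nonneg: "0 \<le> failure_bound K d"
  by (simp add: failure_bound_def)

lemma sum_failure_bound_le:
  assumes "0 < K"
  shows "(\<Sum>d\<in>{1..N}. failure_bound K d) \<le> 28 * real K"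
proof -
  \<comment> \<open>The invariant telescopes by 1/(N+1)^2 \<le> 1/N - 1/(N+1). At
    \<open>N = 4 * K\<close> it equals \<open>16 * K\<close>, enough for the
    \<open>4 * K - 1\<close> trivial terms and the first quadratic term, which is 3.\<close>
  have "(\<Sum>d\<in>{1..N}. failure_bound K d)
    \<le> (if N < 4 * K then real N else 28 * real K - 48 * (real K)^2 / real N)"
  proof (induction N)
    case (Suc N)
    consider "Suc N < 4 * K" | "Suc N = 4 * K" | "4 * K \<le> N" by linarith
    thus ?case
    proof cases
      case 1
      thus ?thesis using Suc by (simp add: failure_bound_def)
    next
      case 2
      have N: "real N = 4 * real K - 1" and K: "1 \<le> real K" using 2 assms by linarith+
      have "failure_bound K (Suc N) = 3"
        using 2 assms by (simp add: failure_bound_def power2_eq_square)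
      moreover have "28 * real K - 48 * (real K)^2 / real (Suc N) = 16 * real K"
        using 2 assms by (simp add: power2_eq_square)
      moreover have "(\<Sum>d\<in>{1..N}. failure_bound K d) \<le> real N" using Suc 2 by simp
      ultimately have "(\<Sum>d\<in>{1..Suc N}. failure_bound K d) \<le> 28 * real K - 48 * (real K)^2 / real (Suc N)"
        using sum.nat_ivl_Suc' [of 1 N "failure_bound K"] N K by simp
      thus ?thesis using 2 by (subst if_not_P) auto
    next
      case 3
      hence N: "0 < real N" using assms by simp
      have "1 / (real (Suc N))^2 \<le> 1 / real N - 1 / real (Suc N)"
      proof -
        have "1 / (real (Suc N))^2 \<le> 1 / (real N * real (Suc N))"
          using N by (intro frac_le) (auto simp: power2_eq_square)
        also have "\<dots> = 1 / real N - 1 / real (Suc N)" using N by (simp add: field_simps)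
        finally show ?thesis .
      qed
      hence "48 * (real K)^2 * (1 / (real (Suc N))^2) \<le> 48 * (real K)^2 * (1 / real N - 1 / real (Suc N))"
        by (intro mult_left_mono) auto
      thus ?thesis using Suc 3 by (simp add: failure_bound_def right_diff_distrib)
    qed
  qed simp
  also have "\<dots> \<le> 28 * real K" by auto
  finally show ?thesis .
qed

text \<open>For fixed \<open>u\<close>, the rank difference is injective on the points before
  \<open>u\<close> and on those after \<open>u\<close>, so each side contributes at most the full
  sum \<open>28 * K\<close>.\<close>

lemma sum_failure_bound_pairs_le:
  assumes \<sigma>: "bij_betw \<sigma> P {..<n}" and "0 < K"
  shows "(\<Sum>(u, v)\<in>P \<times> P - Id. failure_bound K (max (\<sigma> u) (\<sigma> v) - min (\<sigma> u) (\<sigma> v))) \<le> 56 * real n * real K"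
proof -
  let ?f = "\<lambda>x y. failure_bound K (max x y - min x y)"
  have fin: "finite P" using \<sigma> bij_betw_finite by blast
  have inj: "inj_on \<sigma> P" and im: "\<sigma> ` P = {..<n}" using \<sigma> by (auto simp: bij_betw_def)
  have "(\<Sum>(u, v)\<in>P \<times> P - Id. ?f (\<sigma> u) (\<sigma> v)) = (\<Sum>u\<in>P. \<Sum>v\<in>P - {u}. ?f (\<sigma> u) (\<sigma> v))"
    using fin by (subst sum.Sigma) (auto intro!: sum.cong)
  also have "\<dots> \<le> (\<Sum>u\<in>P. 56 * real K)"
  proof (rule sum_mono)
    fix u assume u: "u \<in> P"
    have lt: "\<sigma> v < n" if "v \<in> P" for v using im that by auto
    have *: "(\<Sum>v\<in>A. ?f (\<sigma> u) (\<sigma> v)) \<le> 28 * real K"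
      if A: "A \<subseteq> P" "inj_on (\<lambda>v. max (\<sigma> u) (\<sigma> v) - min (\<sigma> u) (\<sigma> v)) A" "u \<notin> A" for A
    proof -
      have "(\<Sum>v\<in>A. ?f (\<sigma> u) (\<sigma> v)) = sum (failure_bound K) ((\<lambda>v. max (\<sigma> u) (\<sigma> v) - min (\<sigma> u) (\<sigma> v)) ` A)"
        using A by (simp add: sum.reindex)
      also have "\<dots> \<le> sum (failure_bound K) {1..n}"
      proof (rule sum_mono2)
        show "(\<lambda>v. max (\<sigma> u) (\<sigma> v) - min (\<sigma> u) (\<sigma> v)) ` A \<subseteq> {1..n}"
        proof (rule image_subsetI)
          fix v assume v: "v \<in> A"
          have "\<sigma> u \<noteq> \<sigma> v" using v inj A u by (auto simp: inj_on_def)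
          thus "max (\<sigma> u) (\<sigma> v) - min (\<sigma> u) (\<sigma> v) \<in> {1..n}"
            using lt [OF u] lt [of v] v A(1) by (auto simp: max_def min_def)
        qed
      qed (auto simp: failure_bound_nonneg)
      finally show ?thesis using sum_failure_bound_le [OF assms(2), of n] by simp
    qed
    have "P - {u} = {v\<in>P. \<sigma> v < \<sigma> u} \<union> {v\<in>P. \<sigma> u < \<sigma> v}"
      using inj u by (auto simp: inj_on_def) (metis linorder_neqE_nat)
    hence "(\<Sum>v\<in>P - {u}. ?f (\<sigma> u) (\<sigma> v))
      = (\<Sum>v\<in>{v\<in>P. \<sigma> v < \<sigma> u}. ?f (\<sigma> u) (\<sigma> v)) + (\<Sum>v\<in>{v\<in>P. \<sigma> u < \<sigma> v}. ?f (\<sigma> u) (\<sigma> v))"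
      using fin by (simp add: sum.union_disjoint disjoint_iff)
    also have "\<dots> \<le> 28 * real K + 28 * real K"
      using inj by (intro add_mono *) (auto simp: inj_on_def)
    finally show "(\<Sum>v\<in>P - {u}. ?f (\<sigma> u) (\<sigma> v)) \<le> 56 * real K" by simp
  qed
  also have "\<dots> = 56 * real n * real K"
    using bij_betw_same_card [OF \<sigma>] by simp
  finally show ?thesis .
qed

text \<open>The four-hop estimate with \<open>\<kappa> = Suc k\<close>, at the scale
  \<open>k\<close> for which the rank difference lies between \<open>4 * m\<close> and
  \<open>8 * m\<close>, where \<open>m = K * 2 ^ k\<close>. The factor 4 leaves room for disjoint
  layers; the factor 8 is the range of the hubs.\<close>

lemma prob_order_failure:
  assumes \<sigma>: "bij_betw \<sigma> P {..<n}" and F: "finite F" "order_edges K s P \<sigma> \<subseteq> F"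
    and \<psi>: "0 < \<psi>" "\<psi> < 1" and K: "8 * \<psi> powr (- 4 / 3) \<le> real K"
    and s: "n < 2 ^ Suc s" and uv: "u \<in> P" "v \<in> P" "\<sigma> u < \<sigma> v"
  shows "measure_pmf.prob (Pi_pmf F False (\<lambda>_. bernoulli_pmf \<psi>))
      {f. \<not> (\<exists>a\<in>P. \<exists>x\<in>P. \<exists>b\<in>P. \<sigma> u < \<sigma> a \<and> \<sigma> a < \<sigma> x \<and> \<sigma> x < \<sigma> b \<and> \<sigma> b < \<sigma> v \<and>
         f {u, a} \<and> f {a, x} \<and> f {x, b} \<and> f {b, v})} \<le> failure_bound K (\<sigma> v - \<sigma> u)"
    (is "measure_pmf.prob ?M ?E \<le> _")
proof (cases "\<sigma> v - \<sigma> u < 4 * K")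
  case True
  thus ?thesis by (simp add: failure_bound_def)
next
  case False
  have K0: "0 < K" using K \<psi> by (intro gr0I) (auto simp: not_le)
  have inj: "inj_on \<sigma> P" and im: "\<sigma> ` P = {..<n}" using \<sigma> by (auto simp: bij_betw_def)
  have lt: "\<sigma> w < n" if "w \<in> P" for w using im that by auto
  have "1 \<le> (\<sigma> v - \<sigma> u) div (4 * K)"
    using False K0 by (simp add: Suc_le_eq div_greater_zero_iff)
  then obtain k where k: "2 ^ k \<le> (\<sigma> v - \<sigma> u) div (4 * K)" "(\<sigma> v - \<sigma> u) div (4 * K) < 2 ^ (k + 1)"
    using ex_power_ivl1 [of 2] by blast
  define m where "m = K * 2 ^ k"
  have m0: "0 < m" using K0 by (simp add: m_def)
  have d1: "4 * m \<le> \<sigma> v - \<sigma> u"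
    using k(1) K0 by (simp add: m_def less_eq_div_iff_mult_less_eq mult_ac)
  have d2: "\<sigma> v - \<sigma> u < 8 * m"
    using k(2) K0 by (simp add: m_def div_less_iff_less_mult mult_ac)
  have ks: "k \<le> s"
  proof -
    have "2 ^ k \<le> m" using K0 by (simp add: m_def)
    hence "2 ^ k < (2::nat) ^ Suc s" using d1 s lt [OF uv(2)] by linarith
    hence "k < Suc s" by (rule power_less_imp_less_exp [rotated]) simp
    thus ?thesis by simp
  qed
  \<comment> \<open>The sets \<open>A\<close> and \<open>B\<close> thus stay within \<open>m\<close>
    ranks of \<open>u\<close> and \<open>v\<close>, although their size grows with
    \<open>k\<close>.\<close>
  have Kk: "K * Suc k \<le> m" unfolding m_def by (intro mult_le_mono2 Suc_leI less_exp)
  \<comment> \<open>The start of the second block after the one containing \<open>u\<close>: its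
    hubs lie strictly between ranks \<open>\<sigma> u + m\<close> and
    \<open>\<sigma> u + 3 * m\<close>, hence after \<open>A\<close> and before
    \<open>B\<close>.\<close>
  define x0 where "x0 = (\<sigma> u div m + 2) * m"
  have x0: "\<sigma> u + m < x0" "x0 \<le> \<sigma> u + 2 * m"
    using dividend_less_div_times [OF m0, of "\<sigma> u"] div_times_less_eq_dividend [of "\<sigma> u" m]
    by (simp_all add: x0_def algebra_simps)
  define A where "A = {a\<in>P. \<sigma> a \<in> {\<sigma> u<..\<sigma> u + K * Suc k}}"
  define X where "X = {x\<in>P. \<sigma> x \<in> {x0..<x0 + K}}"
  define B where "B = {b\<in>P. \<sigma> b \<in> {\<sigma> v - K * Suc k..<\<sigma> v}}"
  have Km: "K \<le> m" by (simp add: m_def)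
  have card: "card {w\<in>P. \<sigma> w \<in> I} = card I" if "I \<subseteq> {..<n}" for I
  proof (rule bij_betw_same_card)
    show "bij_betw \<sigma> {w\<in>P. \<sigma> w \<in> I} I"
      using that im inj by (auto simp: bij_betw_def inj_on_def image_iff)
  qed
  have A: "\<sigma> u < \<sigma> a" "\<sigma> a \<le> \<sigma> u + K * Suc k" "\<sigma> a \<le> \<sigma> u + m" "a \<in> P" if "a \<in> A" for a
    using that Kk by (auto simp: A_def)
  have X: "\<sigma> u + m < \<sigma> x" "\<sigma> x < \<sigma> u + 3 * m" "x \<in> P" "\<sigma> x mod m < K" if "x \<in> X" for x
  proof -
    have x: "x0 \<le> \<sigma> x" "\<sigma> x < x0 + K" "x \<in> P" using that by (auto simp: X_def)
    thus "\<sigma> u + m < \<sigma> x" "\<sigma> x < \<sigma> u + 3 * m" "x \<in> P" using x0 Km by auto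
    have "\<sigma> x = (\<sigma> x - x0) + (\<sigma> u div m + 2) * m" using x by (simp add: x0_def)
    hence "\<sigma> x mod m = (\<sigma> x - x0) mod m" by (metis mod_mult_self1)
    also have "\<dots> \<le> \<sigma> x - x0" by (rule mod_less_eq_dividend)
    also have "\<dots> < K" using x by linarith
    finally show "\<sigma> x mod m < K" .
  qed
  have B: "\<sigma> b < \<sigma> v" "\<sigma> v \<le> \<sigma> b + K * Suc k" "\<sigma> u + 3 * m \<le> \<sigma> b" "b \<in> P" if "b \<in> B" for b
    using that Kk d1 by (auto simp: B_def)
  have near: "{p, q} \<in> F" if "p \<in> P" "q \<in> P" "\<sigma> p < \<sigma> q" "\<sigma> q \<le> \<sigma> p + K * Suc k" for p q
  proof -
    have "K * Suc k \<le> K * Suc s" using ks by simp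
    hence "line_adj K s (\<sigma> p) (\<sigma> q)" using that unfolding line_adj_def by linarith
    thus ?thesis using that F(2) by (auto intro!: order_edgesI subsetD [OF F(2)])
  qed
  have far: "{p, q} \<in> F" if "p \<in> P" "q \<in> P" "p \<noteq> q" "\<sigma> p mod m < K" "\<sigma> q \<le> \<sigma> p + 8 * m" "\<sigma> p \<le> \<sigma> q + 8 * m" for p q
  proof -
    have "line_adj K s (\<sigma> p) (\<sigma> q)" using that ks unfolding line_adj_def m_def by blast
    thus ?thesis using that F(2) by (auto intro!: order_edgesI subsetD [OF F(2)])
  qed
  have sep: "\<sigma> u < \<sigma> a \<and> \<sigma> a < \<sigma> x \<and> \<sigma> x < \<sigma> b \<and> \<sigma> b < \<sigma> v" if "a \<in> A" "x \<in> X" "b \<in> B" for a x b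
    using A [OF that(1)] X [OF that(2)] B [OF that(3)] by linarith
  have "measure_pmf.prob ?M ?E \<le> measure_pmf.prob ?M {f. \<not> (\<exists>a\<in>A. \<exists>x\<in>X. \<exists>b\<in>B. f {u, a} \<and> f {a, x} \<and> f {x, b} \<and> f {b, v})}"
    using sep A X B by (intro measure_pmf.finite_measure_mono) (simp_all, blast)
  also have "\<dots> \<le> 3 / 4 ^ Suc k"
  proof (rule prob_four_hop_failure [where K = K])
    have fin: "finite P" using \<sigma> bij_betw_finite by blast
    thus "finite A" "finite X" "finite B" by (auto simp: A_def X_def B_def)
    show "card A = K * Suc k" "card X = K" "card B = K * Suc k"
      unfolding A_def X_def B_def using lt [OF uv(2)] d1 Kk x0 Km
      by (subst card; auto)+
    show "u \<notin> A" "u \<notin> X" "u \<notin> B" "v \<notin> A" "v \<notin> X" "v \<notin> B"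
      using A(1) [of u] X(1) [of u] B(3) [of u] A(3) [of v] X(2) [of v] B(1) [of v] d1 m0 by fastforce+
    show "A \<inter> X = {}" using A(3) X(1) by fastforce
    show "A \<inter> B = {}" using A(3) B(3) m0 by fastforce
    show "X \<inter> B = {}" using X(2) B(3) by fastforce
    show "u \<noteq> v" using uv by auto
    show "{u, a} \<in> F" if "a \<in> A" for a using A [OF that] uv by (intro near) auto
    show "{b, v} \<in> F" if "b \<in> B" for b using B [OF that] uv by (intro near) auto
    show "{a, x} \<in> F" if "a \<in> A" "x \<in> X" for a x
      using A [OF that(1)] X [OF that(2)] by (subst insert_commute, intro far) auto
    show "{x, b} \<in> F" if "x \<in> X" "b \<in> B" for x b
      using X [OF that(1)] B [OF that(2)] d2 by (intro far) auto
  qed (use F \<psi> K in auto)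
  also have "\<dots> \<le> failure_bound K (\<sigma> v - \<sigma> u)"
  proof -
    \<comment> \<open>From \<open>d < 4 * K * 2 ^ Suc k\<close> one gets
      \<open>4 ^ Suc k \<ge> d^2 / (16 * K^2)\<close>; this is the origin of 48 = 3 * 16.\<close>
    define d where "d = real (\<sigma> v - \<sigma> u)"
    have d: "0 < d" using uv by (simp add: d_def)
    have "d < real (8 * m)" unfolding d_def using d2 of_nat_less_iff by blast
    hence "d \<le> 4 * real K * 2 ^ Suc k" by (simp add: m_def)
    hence "d^2 \<le> (4 * real K * 2 ^ Suc k)^2" using d by (intro power_mono) auto
    also have "\<dots> = 16 * (real K)^2 * 4 ^ Suc k"
      by (simp add: power_mult_distrib power2_eq_square flip: power_mult_distrib)
    finally have "3 / 4 ^ Suc k \<le> 48 * (real K)^2 / d^2"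
      using d by (simp add: field_simps)
    thus ?thesis using False by (simp add: failure_bound_def d_def)
  qed
  finally show ?thesis .
qed

section \<open>Locality-sensitive orders\<close>

text \<open>The set \<open>U\<close> is an initial segment of the order on \<open>P\<close> and
  marks where the part near \<open>u\<close> ends. It prevents a monotone path from alternating
  between the two ends.\<close>

definition separates :: "('a::metric_space \<Rightarrow> nat) \<Rightarrow> 'a set \<Rightarrow> real \<Rightarrow> 'a \<Rightarrow> 'a \<Rightarrow> bool" where
  "separates \<sigma> P \<delta> u v \<longleftrightarrow> \<sigma> u < \<sigma> v \<and>
     (\<exists>U. (\<forall>x\<in>P. \<forall>y\<in>P. \<sigma> x \<le> \<sigma> y \<longrightarrow> y \<in> U \<longrightarrow> x \<in> U) \<and>
          (\<forall>x\<in>P. \<sigma> u \<le> \<sigma> x \<longrightarrow> \<sigma> x \<le> \<sigma> v \<longrightarrow>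
             (if x \<in> U then dist u x else dist x v) \<le> \<delta> * dist u v))"

text \<open>Only the order induced on \<open>P\<close> matters, so large codes can later be replaced
  by ranks.\<close>

lemma separates_cong:
  assumes "separates \<sigma> P \<delta> u v" "u \<in> P" "v \<in> P"
    and "\<And>x y. x \<in> P \<Longrightarrow> y \<in> P \<Longrightarrow> \<sigma>' x < \<sigma>' y \<longleftrightarrow> \<sigma> x < \<sigma> y"
  shows "separates \<sigma>' P \<delta> u v"
proof -
  have "\<sigma>' x \<le> \<sigma>' y \<longleftrightarrow> \<sigma> x \<le> \<sigma> y" if "x \<in> P" "y \<in> P" for x y
    using assms(4)[OF that(2,1)] by (simp flip: not_less)
  with assms show ?thesis unfolding separates_def by (simp cong: ball_cong)
qed

lemma ex_rank:
  fixes f :: "'a \<Rightarrow> nat"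
  assumes "finite P" "inj_on f P"
  shows "\<exists>\<rho>. bij_betw \<rho> P {..<card P} \<and> (\<forall>x\<in>P. \<forall>y\<in>P. \<rho> x < \<rho> y \<longleftrightarrow> f x < f y)"
proof -
  define \<rho> where "\<rho> = (\<lambda>x. card {y\<in>P. f y < f x})"
  have mono: "\<rho> x < \<rho> y" if "x \<in> P" "f x < f y" for x y
    unfolding \<rho>_def using assms that by (intro psubset_card_mono) auto
  have iff: "\<rho> x < \<rho> y \<longleftrightarrow> f x < f y" if "x \<in> P" "y \<in> P" for x y
    using mono [of x y] mono [of y x] that assms(2)
    by (metis inj_onD linorder_neqE_nat not_less_iff_gr_or_eq)
  have inj: "inj_on \<rho> P"
  proof (rule inj_onI)
    fix x y assume "x \<in> P" "y \<in> P" "\<rho> x = \<rho> y"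
    thus "x = y" using iff [of x y] iff [of y x] assms(2) by (simp add: inj_on_eq_iff)
  qed
  have "\<rho> ` P \<subseteq> {..<card P}"
    unfolding \<rho>_def using assms(1) by (auto intro!: psubset_card_mono)
  hence "\<rho> ` P = {..<card P}"
    using inj by (intro card_subset_eq) (auto simp: card_image)
  thus ?thesis using inj iff by (auto simp: bij_betw_def)
qed

text \<open>Keys that give every orbit \<open>{a, r a}\<close> consecutive values \<open>2 m\<close> and \<open>2 m + 1\<close>.\<close>

lemma ex_involution_key:
  assumes "finite V" and r: "\<And>a. a \<in> V \<Longrightarrow> r a \<in> V" "\<And>a. a \<in> V \<Longrightarrow> r (r a) = a"
  shows "\<exists>\<kappa>::'a \<Rightarrow> nat. inj_on \<kappa> V \<and> (\<forall>a\<in>V. \<kappa> a < 2 * card V) \<and> (\<forall>a\<in>V. \<kappa> (r a) div 2 = \<kappa> a div 2)"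
proof -
  obtain h where h: "bij_betw h V {0..<card V}"
    using ex_bij_betw_finite_nat [OF assms(1)] by blast
  have inj: "h a = h b \<longleftrightarrow> a = b" if "a \<in> V" "b \<in> V" for a b
    using h that by (auto simp: bij_betw_def inj_on_def)
  have lt: "h a < card V" if "a \<in> V" for a using h that by (auto simp: bij_betw_def)
  \<comment> \<open>The minimum names the orbit and the last bit tells its two elements apart; a
    fixed point gets the even value.\<close>
  define \<kappa> where "\<kappa> = (\<lambda>a. 2 * min (h a) (h (r a)) + (if h a \<le> h (r a) then 0 else 1))"
  have half: "\<kappa> a div 2 = min (h a) (h (r a))" for a by (simp add: \<kappa>_def)
  have "inj_on \<kappa> V"
  proof (rule inj_onI)
    fix a b assume ab: "a \<in> V" "b \<in> V" "\<kappa> a = \<kappa> b"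
    have 1: "min (h a) (h (r a)) = min (h b) (h (r b))" using ab half by metis
    have 2: "h a \<le> h (r a) \<longleftrightarrow> h b \<le> h (r b)"
      using ab(3) 1 by (simp add: \<kappa>_def split: if_splits)
    have "h a = h b \<or> h (r a) = h (r b)" using 1 2 by (auto simp: min_def split: if_splits)
    thus "a = b" using ab(1,2) inj r by metis
  qed
  moreover have "\<kappa> a < 2 * card V" if "a \<in> V" for a
    using lt [OF that] lt [OF r(1) [OF that]] by (auto simp: \<kappa>_def min_def)
  moreover have "\<kappa> (r a) div 2 = \<kappa> a div 2" if "a \<in> V" for a
    using that r by (simp add: half min.commute)
  ultimately show ?thesis by blast
qed

section \<open>Keys for the children of a grid cell\<close>

text \<open>The positions of the \<open>R ^ d\<close> children inside a cell, where
  \<open>R = 2 ^ l\<close> is the ratio between consecutive levels.\<close>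

definition digits :: "nat \<Rightarrow> ('d \<Rightarrow> int) set" where
  "digits l = {a. \<forall>i. 0 \<le> a i \<and> a i < 2 ^ l}"

lemma digits:
  shows "finite (digits l :: ('d::finite \<Rightarrow> int) set)"
    and "card (digits l :: ('d::finite \<Rightarrow> int) set) = (2 ^ l) ^ CARD('d)"
proof -
  have *: "(digits l :: ('d \<Rightarrow> int) set) = (UNIV \<rightarrow>\<^sub>E {0..<2 ^ l})"
    by (auto simp: digits_def)
  show "finite (digits l :: ('d \<Rightarrow> int) set)" unfolding * by (intro finite_PiE) auto
  show "card (digits l :: ('d \<Rightarrow> int) set) = (2 ^ l) ^ CARD('d)"
    unfolding * by (subst card_PiE) (auto simp: nat_power_eq)
qed

text \<open>The reflections \<open>a \<mapsto> t - a\<close> of \<open>\<int>\<^sub>R\<^sup>d\<close> cover all pairs with only \<open>R\<^sup>d\<close> matchings.\<close>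

lemma ex_digit_keys:
  "\<exists>\<kappa> :: ('d::finite \<Rightarrow> int) \<Rightarrow> ('d \<Rightarrow> int) \<Rightarrow> nat.
     (\<forall>t. inj_on (\<kappa> t) (digits l) \<and> (\<forall>a\<in>digits l. \<kappa> t a < 2 * (2 ^ l) ^ CARD('d))) \<and>
     (\<forall>a\<in>digits l. \<forall>b\<in>digits l. \<exists>t\<in>digits l. \<kappa> t a div 2 = \<kappa> t b div 2)"
proof -
  define r where "r = (\<lambda>(t :: 'd \<Rightarrow> int) a i. (t i - a i) mod 2 ^ l)"
  have "\<exists>\<kappa> :: ('d \<Rightarrow> int) \<Rightarrow> nat. inj_on \<kappa> (digits l) \<and>
      (\<forall>a\<in>digits l. \<kappa> a < 2 * card (digits l :: ('d \<Rightarrow> int) set)) \<and>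
      (\<forall>a\<in>digits l. \<kappa> (r t a) div 2 = \<kappa> a div 2)" for t
  proof (rule ex_involution_key)
    fix a :: "'d \<Rightarrow> int" assume "a \<in> digits l"
    thus "r t (r t a) = a" by (auto simp: r_def digits_def mod_simps)
  qed (auto simp: digits, auto simp: r_def digits_def)
  then obtain \<kappa> :: "('d \<Rightarrow> int) \<Rightarrow> ('d \<Rightarrow> int) \<Rightarrow> nat" where \<kappa>:
    "\<And>t. inj_on (\<kappa> t) (digits l)" "\<And>t a. a \<in> digits l \<Longrightarrow> \<kappa> t a < 2 * (2 ^ l) ^ CARD('d)"
    "\<And>t a. a \<in> digits l \<Longrightarrow> \<kappa> t (r t a) div 2 = \<kappa> t a div 2"
    unfolding digits by metis
  have "\<exists>t\<in>digits l. \<kappa> t a div 2 = \<kappa> t b div 2" if "a \<in> digits l" "b \<in> digits l" for a b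
  proof
    \<comment> \<open>The reflection at \<open>a + b\<close> exchanges \<open>a\<close> and
      \<open>b\<close>.\<close>
    let ?t = "\<lambda>i. (a i + b i) mod 2 ^ l"
    show "?t \<in> digits l" by (simp add: digits_def)
    have "r ?t a = b" using that by (auto simp: r_def digits_def mod_simps)
    thus "\<kappa> ?t a div 2 = \<kappa> ?t b div 2" using \<kappa>(3) [of a ?t] that by simp
  qed
  with \<kappa> show ?thesis by blast
qed

section \<open>Shifted dyadic grids\<close>

text \<open>The index vector of the level-\<open>k\<close> cell of side \<open>W / 2 ^ k\<close>
  containing \<open>p\<close>. The shift is added before scaling, so that the grids of all levels
  are nested; measured in cells of level \<open>k\<close> it is \<open>2 ^ k / 3\<close>.\<close>

definition cell :: "real \<Rightarrow> ('d \<Rightarrow> bool) \<Rightarrow> nat \<Rightarrow> real ^ 'd \<Rightarrow> 'd \<Rightarrow> int" where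
  "cell W s k p = (\<lambda>i. \<lfloor>2 ^ k * (p $ i / W + (if s i then 1 / 3 else 0))\<rfloor>)"

lemma cell_div: "cell W s k p i = cell W s (k + l) p i div 2 ^ l"
proof -
  have "cell W s (k + l) p i div 2 ^ l
    = \<lfloor>2 ^ (k + l) * (p $ i / W + (if s i then 1 / 3 else 0)) / real_of_int (2 ^ l)\<rfloor>"
    unfolding cell_def by (subst floor_divide_real_eq_div) auto
  also have "\<dots> = cell W s k p i" by (simp add: cell_def power_add)
  finally show ?thesis ..
qed

lemma cell_eq_iff:
  "cell W s (k + l) p = cell W s (k + l) q \<longleftrightarrow>
     cell W s k p = cell W s k q \<and>
     (\<lambda>i. cell W s (k + l) p i mod 2 ^ l) = (\<lambda>i. cell W s (k + l) q i mod 2 ^ l)"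
    (is "?L \<longleftrightarrow> ?R1 \<and> ?R2")
proof
  assume ?L thus "?R1 \<and> ?R2" using cell_div [of W s k _ _ l] by (auto simp: fun_eq_iff)
next
  assume R: "?R1 \<and> ?R2"
  show ?L
  proof
    fix i
    have "cell W s (k + l) p i div 2 ^ l = cell W s (k + l) q i div 2 ^ l"
      using R by (simp flip: cell_div)
    moreover have "cell W s (k + l) p i mod 2 ^ l = cell W s (k + l) q i mod 2 ^ l"
      using R by (auto dest: fun_cong)
    ultimately show "cell W s (k + l) p i = cell W s (k + l) q i" by (metis mult_div_mod_eq)
  qed
qed

lemma same_cell_dist:
  fixes p q :: "real ^ 'd::finite"
  assumes "cell W s k p = cell W s k q" "0 < W"
  shows "dist p q \<le> real CARD('d) * (W / 2 ^ k)"
proof -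
  have "\<bar>(p - q) $ i\<bar> \<le> W / 2 ^ k" for i
  proof -
    have "\<lfloor>2 ^ k * (p $ i / W + (if s i then 1 / 3 else 0))\<rfloor> = \<lfloor>2 ^ k * (q $ i / W + (if s i then 1 / 3 else 0))\<rfloor>"
      using fun_cong [OF assms(1), of i] by (simp only: cell_def)
    hence "\<bar>2 ^ k * (p $ i / W + (if s i then 1 / 3 else 0)) - 2 ^ k * (q $ i / W + (if s i then 1 / 3 else 0))\<bar> \<le> 1"
      by linarith
    hence "\<bar>2 ^ k * ((p - q) $ i / W)\<bar> \<le> 1"
      by (simp add: algebra_simps diff_divide_distrib)
    hence "2 ^ k * \<bar>(p - q) $ i\<bar> / W \<le> 1"
      using assms(2) by (simp add: abs_mult del: vector_minus_component)
    thus ?thesis using assms(2) by (simp add: field_simps del: vector_minus_component)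
  qed
  hence "(\<Sum>i\<in>UNIV. \<bar>(p - q) $ i\<bar>) \<le> (\<Sum>i::'d\<in>UNIV. W / 2 ^ k)" by (intro sum_mono)
  moreover have "dist p q \<le> (\<Sum>i\<in>UNIV. \<bar>(p - q) $ i\<bar>)"
    unfolding dist_norm by (rule norm_le_l1_cart)
  ultimately show ?thesis by simp
qed

text \<open>A cell boundary between \<open>y\<close> and \<open>z\<close> in both grids would give two points of
  \<open>\<int>\<close> and \<open>\<int> - 2\<^sup>k/3\<close> at distance less than \<open>1/3\<close>, whereas \<open>3\<close> does not divide \<open>2\<^sup>k\<close>.\<close>

lemma floor_shift_third:
  fixes y z :: real
  assumes "\<bar>y - z\<bar> < 1 / 3"
  shows "\<lfloor>y\<rfloor> = \<lfloor>z\<rfloor> \<or> \<lfloor>y + 2 ^ k / 3\<rfloor> = \<lfloor>z + 2 ^ k / 3\<rfloor>"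
  using assms
proof (induction y z rule: linorder_wlog)
  case (le y z)
  show ?case
  proof (rule ccontr)
    assume neq: "\<not> ?thesis"
    define m where "m = \<lfloor>z\<rfloor>"
    define m' where "m' = \<lfloor>z + 2 ^ k / 3\<rfloor>"
    have "\<lfloor>y\<rfloor> < m" using neq le(1) floor_mono [of y z] unfolding m_def by linarith
    hence m: "y < m" "m \<le> z" unfolding m_def by linarith+
    have "\<lfloor>y + 2 ^ k / 3\<rfloor> < m'"
      using neq le(1) floor_mono [of "y + 2 ^ k / 3" "z + 2 ^ k / 3"] unfolding m'_def by linarith
    hence m': "y + 2 ^ k / 3 < m'" "m' \<le> z + 2 ^ k / 3" unfolding m'_def by linarith+
    have "\<bar>real_of_int (3 * m + 2 ^ k - 3 * m')\<bar> < 1"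
      using m m' le by (simp add: abs_less_iff)
    hence "3 * m + 2 ^ k - 3 * m' = 0" by linarith
    hence "(2::int) ^ k = 3 * (m' - m)" by simp
    hence "3 dvd (2::int) ^ k" by simp
    moreover have "coprime (3::int) (2 ^ k)" by simp
    ultimately have "is_unit (3 :: int)" by (simp only: coprime_absorb_left)
    thus False by simp
  qed
next
  case (sym y z)
  thus ?case by (metis abs_minus_commute)
qed

text \<open>In every coordinate the points differ by less than a third of a cell, so one of the two
  shifts works there. The choice is made coordinate by coordinate, whence the \<open>2 ^ d\<close>
  possible vectors \<open>s\<close>.\<close>

lemma ex_shift_same_cell:
  fixes u v :: "real ^ 'd::finite"
  assumes "0 < W" "3 * dist u v * 2 ^ k < W"
  shows "\<exists>s. cell W s k u = cell W s k v"
proof -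
  have "\<lfloor>2 ^ k * (u $ i / W)\<rfloor> = \<lfloor>2 ^ k * (v $ i / W)\<rfloor> \<or>
    \<lfloor>2 ^ k * (u $ i / W) + 2 ^ k / 3\<rfloor> = \<lfloor>2 ^ k * (v $ i / W) + 2 ^ k / 3\<rfloor>" for i
  proof (rule floor_shift_third)
    have "\<bar>2 ^ k * (u $ i / W) - 2 ^ k * (v $ i / W)\<bar> = 2 ^ k * \<bar>(u - v) $ i\<bar> / W"
      using assms(1) by (simp add: abs_mult flip: right_diff_distrib diff_divide_distrib)
    also have "\<dots> \<le> 2 ^ k * dist u v / W"
      unfolding dist_norm using assms(1) component_le_norm_cart [of "u - v" i]
      by (intro divide_right_mono mult_left_mono) auto
    also have "\<dots> < 1 / 3" using assms by (simp add: field_simps)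
    finally show "\<bar>2 ^ k * (u $ i / W) - 2 ^ k * (v $ i / W)\<bar> < 1 / 3" .
  qed
  hence "\<exists>b. \<lfloor>2 ^ k * (u $ i / W + (if b then 1 / 3 else 0))\<rfloor> = \<lfloor>2 ^ k * (v $ i / W + (if b then 1 / 3 else 0))\<rfloor>" for i
    unfolding ex_bool_eq by (simp add: distrib_left disj_commute)
  then obtain s where "\<And>i. \<lfloor>2 ^ k * (u $ i / W + (if s i then 1 / 3 else 0))\<rfloor> = \<lfloor>2 ^ k * (v $ i / W + (if s i then 1 / 3 else 0))\<rfloor>"
    by metis
  thus ?thesis unfolding cell_def by blast
qed

text \<open>A base \<open>2 R\<^sup>d\<close> numeral whose digits encode the path to \<open>p\<close> in the hierarchy of grids of levels
  \<open>r, r + l, r + 2 l, \<dots>\<close>, where \<open>R = 2\<^sup>l\<close>. The leading digit, an arbitrary code of the top cell, may be large.\<close>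

primrec code :: "real \<Rightarrow> ('d::finite \<Rightarrow> bool) \<Rightarrow> nat \<Rightarrow> nat \<Rightarrow> (('d \<Rightarrow> int) \<Rightarrow> nat) \<Rightarrow> nat \<Rightarrow> real ^ 'd \<Rightarrow> nat" where
  "code W s l r \<kappa> 0 p = to_nat (cell W s r p)"
| "code W s l r \<kappa> (Suc j) p = 2 * (2 ^ l) ^ CARD('d) * code W s l r \<kappa> j p
     + \<kappa> (\<lambda>i. cell W s (r + j * l + l) p i mod 2 ^ l)"

section \<open>The order defined by the codes\<close>

context
  fixes W :: real and s :: "'d::finite \<Rightarrow> bool" and l r :: nat and \<kappa> :: "('d \<Rightarrow> int) \<Rightarrow> nat"
  assumes inj: "inj_on \<kappa> (digits l)" and lt: "\<And>a. a \<in> digits l \<Longrightarrow> \<kappa> a < 2 * (2 ^ l) ^ CARD('d)"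
begin

lemma key_lt: "\<kappa> (\<lambda>i. cell W s k p i mod 2 ^ l) < 2 * (2 ^ l) ^ CARD('d)"
  by (rule lt) (simp add: digits_def)

lemma code_Suc_div: "code W s l r \<kappa> (Suc j) p div (2 * (2 ^ l) ^ CARD('d)) = code W s l r \<kappa> j p"
  using key_lt by simp

text \<open>Keys are smaller than the base, so quotient and remainder recover the previous code and
  the last key. The key determines the digit, and the digit together with the parent cell determines
  the cell.\<close>

lemma code_eq_iff:
  "code W s l r \<kappa> j p = code W s l r \<kappa> j q \<longleftrightarrow> cell W s (r + j * l) p = cell W s (r + j * l) q"
proof (induction j)
  case (Suc j)
  let ?B = "2 * (2 ^ l) ^ CARD('d) :: nat"
  let ?d = "\<lambda>p i. cell W s (r + j * l + l) p i mod 2 ^ l"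
  have "code W s l r \<kappa> (Suc j) p mod ?B = \<kappa> (?d p)" for p
    using key_lt by simp
  hence "code W s l r \<kappa> (Suc j) p = code W s l r \<kappa> (Suc j) q \<longleftrightarrow>
      code W s l r \<kappa> j p = code W s l r \<kappa> j q \<and> \<kappa> (?d p) = \<kappa> (?d q)"
    by (metis code_Suc_div mult_div_mod_eq)
  also have "\<kappa> (?d p) = \<kappa> (?d q) \<longleftrightarrow> ?d p = ?d q"
    by (rule inj_on_eq_iff [OF inj]) (auto simp: digits_def)
  also have "code W s l r \<kappa> j p = code W s l r \<kappa> j q \<and> ?d p = ?d q \<longleftrightarrow>
      cell W s (r + j * l + l) p = cell W s (r + j * l + l) q"
    unfolding Suc.IH by (rule cell_eq_iff [symmetric])
  finally show ?case by (simp add: add_ac)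
qed simp

text \<open>Dropping final digits is division by the base and hence monotone. Every cell of the
  hierarchy is therefore an interval of the order.\<close>

lemma code_mono:
  assumes "code W s l r \<kappa> J p \<le> code W s l r \<kappa> J q" "j \<le> J"
  shows "code W s l r \<kappa> j p \<le> code W s l r \<kappa> j q"
  using assms(2,1)
proof (induction rule: inc_induct)
  case (step j)
  thus ?case using div_le_mono code_Suc_div by metis
qed

text \<open>\<open>u\<close> and \<open>v\<close> lie in a common cell, in children whose keys have
  the same half. No third child comes between these two, so a point between \<open>u\<close> and
  \<open>v\<close> lies in one of them; \<open>U\<close> ends with the child of
  \<open>u\<close>.\<close>

lemma separates_code:
  fixes u v :: "real ^ 'd"
  assumes cell: "cell W s (r + j * l) u = cell W s (r + j * l) v"
    and key: "\<kappa> (\<lambda>i. cell W s (r + j * l + l) u i mod 2 ^ l) div 2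
            = \<kappa> (\<lambda>i. cell W s (r + j * l + l) v i mod 2 ^ l) div 2"
    and J: "Suc j \<le> J" and le: "code W s l r \<kappa> J u < code W s l r \<kappa> J v"
    and near: "\<And>x y. x \<in> P \<Longrightarrow> y \<in> {u, v} \<Longrightarrow> cell W s (r + j * l + l) x = cell W s (r + j * l + l) y \<Longrightarrow>
       dist x y \<le> \<delta> * dist u v"
  shows "separates (code W s l r \<kappa> J) P \<delta> u v"
proof -
  let ?c = "code W s l r \<kappa> (Suc j)"
  let ?U = "{x. ?c x \<le> ?c u}"
  have "code W s l r \<kappa> j u = code W s l r \<kappa> j v" using cell by (simp add: code_eq_iff)
  \<comment> \<open>The base is even, so halving the code leaves the contribution of the parent
    integral and halves the key.\<close>
  hence half: "?c u div 2 = ?c v div 2"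
    using key by (simp add: mult.assoc)
  have cell': "cell W s (r + j * l + l) x = cell W s (r + j * l + l) y" if "?c x = ?c y" for x y
    using that code_eq_iff [of "Suc j"] by (simp add: add_ac)
  have "(if x \<in> ?U then dist u x else dist x v) \<le> \<delta> * dist u v"
    if x: "x \<in> P" "code W s l r \<kappa> J u \<le> code W s l r \<kappa> J x" "code W s l r \<kappa> J x \<le> code W s l r \<kappa> J v" for x
  proof -
    have "?c u \<le> ?c x" "?c x \<le> ?c v" using x code_mono [OF _ J] by auto
    hence "?c x = ?c u \<or> ?c x = ?c v" using half by linarith
    show ?thesis
    proof (cases "x \<in> ?U")
      case True
      hence "?c x = ?c u" using \<open>?c u \<le> ?c x\<close> by simp
      hence "dist x u \<le> \<delta> * dist u v" by (intro near x(1) cell') auto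
      thus ?thesis using True by (simp only: if_True dist_commute)
    next
      case False
      hence "?c x = ?c v" using \<open>?c x = ?c u \<or> ?c x = ?c v\<close> by auto
      hence "dist x v \<le> \<delta> * dist u v" by (intro near x(1) cell') auto
      thus ?thesis using False by (simp only: if_False)
    qed
  qed
  moreover have "\<forall>x\<in>P. \<forall>y\<in>P. code W s l r \<kappa> J x \<le> code W s l r \<kappa> J y \<longrightarrow> y \<in> ?U \<longrightarrow> x \<in> ?U"
    using code_mono [OF _ J] by (force simp del: code.simps)
  ultimately show ?thesis using le unfolding separates_def by blast
qed

end

section \<open>The family of all orders\<close>

lemma separates_mono:
  assumes "separates \<sigma> P \<delta> u v" "\<delta> \<le> \<delta>'"
  shows "separates \<sigma> P \<delta>' u v"
proof -
  obtain U where U: "\<sigma> u < \<sigma> v" "\<forall>x\<in>P. \<forall>y\<in>P. \<sigma> x \<le> \<sigma> y \<longrightarrow> y \<in> U \<longrightarrow> x \<in> U"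
    "\<And>x. x \<in> P \<Longrightarrow> \<sigma> u \<le> \<sigma> x \<Longrightarrow> \<sigma> x \<le> \<sigma> v \<Longrightarrow>
       (if x \<in> U then dist u x else dist x v) \<le> \<delta> * dist u v"
    using assms(1) unfolding separates_def by blast
  have "\<delta> * dist u v \<le> \<delta>' * dist u v"
    using assms(2) by (intro mult_right_mono) auto
  note order.trans [OF U(3) this]
  with U(1,2) show ?thesis unfolding separates_def by blast
qed

lemma ex_dyadic_scale:
  fixes D W :: real
  assumes "0 < D" "D < W"
  shows "\<exists>k. D * 2 ^ k < W \<and> W \<le> 2 * D * 2 ^ k"
proof -
  define k where "k = (LEAST k. W \<le> D * 2 ^ k)"
  obtain k0 where "W / D < 2 ^ k0" using real_arch_pow [of 2] by auto
  hence "W \<le> D * 2 ^ k0" using assms by (simp add: field_simps)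
  hence k: "W \<le> D * 2 ^ k" unfolding k_def by (rule LeastI)
  with assms obtain k' where k': "k = Suc k'" by (cases k) auto
  have "\<not> W \<le> D * 2 ^ k'"
    using not_less_Least [of k' "\<lambda>k. W \<le> D * 2 ^ k"] k' unfolding k_def by simp
  with k k' show ?thesis by (intro exI [of _ k']) auto
qed

text \<open>Orders are indexed by a shift \<open>s\<close>, a residue \<open>r\<close> of the level
  modulo \<open>l\<close>, and a reflection \<open>t\<close>. For given \<open>u\<close> and
  \<open>v\<close> one takes a level whose cell side is between 3 and 6 times their distance, a
  shift that puts them into one cell, and a reflection that makes their children consecutive. The
  children have diameter at most \<open>6 * d / 2 ^ l\<close> times the distance.\<close>

lemma ex_dyadic_orders:
  fixes P :: "(real ^ 'd::finite) set"
  assumes fin: "finite P" and l: "6 * CARD('d) < 2 ^ l"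
  shows "\<exists>S. finite S \<and> card S \<le> 2 ^ CARD('d) * l * (2 ^ l) ^ CARD('d) \<and>
     (\<forall>\<sigma>\<in>S. bij_betw \<sigma> P {..<card P}) \<and>
     (\<forall>u\<in>P. \<forall>v\<in>P. u \<noteq> v \<longrightarrow>
        (\<exists>\<sigma>\<in>S. separates \<sigma> P (6 * CARD('d) / 2 ^ l) u v \<or> separates \<sigma> P (6 * CARD('d) / 2 ^ l) v u))"
proof -
  let ?d = "real CARD('d)"
  let ?\<delta> = "6 * ?d / 2 ^ l"
  have d: "1 \<le> ?d" by simp
  have l0: "0 < l" using l by (cases l) auto
  have \<delta>: "?\<delta> < 1"
    using l by (simp flip: of_nat_less_iff [where 'a = real])
  define E where "E = (\<lambda>(u, v). dist u v) ` (P \<times> P - Id)"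
  have fE: "finite E" using fin by (auto simp: E_def)
  \<comment> \<open>\<open>W\<close> exceeds three times every distance, so a suitable level exists
    for every pair, while \<open>\<mu>\<close> is a positive lower bound for distances of distinct
    points and gives a depth \<open>J\<close> at which the cells isolate them.\<close>
  define W where "W = 1 + 3 * Max (insert 0 E)"
  define \<mu> where "\<mu> = Min (insert 1 E)"
  have \<mu>: "0 < \<mu>" unfolding \<mu>_def using fE by (auto simp: E_def)
  have W0: "0 < W" unfolding W_def using fE by (simp add: add_pos_nonneg)
  have W: "3 * dist u v < W" and \<mu>': "\<mu> \<le> dist u v" if "u \<in> P" "v \<in> P" "u \<noteq> v" for u v
  proof -
    have "dist u v \<in> E" using that by (auto simp: E_def intro!: image_eqI [of _ _ "(u, v)"])
    hence "dist u v \<le> Max (insert 0 E)" "Min (insert 1 E) \<le> dist u v"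
      using fE by (auto intro: Max_ge Min_le)
    thus "3 * dist u v < W" "\<mu> \<le> dist u v" by (simp_all add: W_def \<mu>_def)
  qed
  obtain J where "?d * W / \<mu> < 2 ^ J" using real_arch_pow [of 2] by auto
  hence J: "?d * W < \<mu> * 2 ^ J" using \<mu> by (simp add: field_simps)
  obtain \<kappa> :: "('d \<Rightarrow> int) \<Rightarrow> ('d \<Rightarrow> int) \<Rightarrow> nat" where \<kappa>:
    "\<And>t. inj_on (\<kappa> t) (digits l)" "\<And>t a. a \<in> digits l \<Longrightarrow> \<kappa> t a < 2 * (2 ^ l) ^ CARD('d)"
    "\<And>a b. a \<in> digits l \<Longrightarrow> b \<in> digits l \<Longrightarrow> \<exists>t\<in>digits l. \<kappa> t a div 2 = \<kappa> t b div 2"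
    using ex_digit_keys [of l, where 'd = 'd] by blast
  define c where "c = (\<lambda>(s, r, t). code W s l r (\<kappa> t) J)"
  have "inj_on (c z) P" for z
  proof (rule inj_onI)
    fix u v assume uv: "u \<in> P" "v \<in> P" "c z u = c z v"
    obtain s r t where z: "z = (s, r, t)" by (cases z)
    have "cell W s (r + J * l) u = cell W s (r + J * l) v"
      using uv(3) by (simp add: c_def z code_eq_iff [OF \<kappa>(1,2)])
    hence "dist u v \<le> ?d * (W / 2 ^ (r + J * l))" by (rule same_cell_dist [OF _ W0])
    also have "\<dots> \<le> ?d * (W / 2 ^ J)"
    proof -
      have "J \<le> J * l" using l0 by simp
      hence "(2::real) ^ J \<le> 2 ^ (r + J * l)" by (intro power_increasing) linarith+
      thus ?thesis using W0 by (intro mult_left_mono divide_left_mono) auto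
    qed
    also have "\<dots> < \<mu>" using J by (simp add: field_simps)
    finally show "u = v" using \<mu>' [OF uv(1,2)] by force
  qed
  hence "\<exists>\<rho>. bij_betw \<rho> P {..<card P} \<and> (\<forall>x\<in>P. \<forall>y\<in>P. \<rho> x < \<rho> y \<longleftrightarrow> c z x < c z y)" for z
    by (rule ex_rank [OF fin])
  then obtain \<rho> where \<rho>: "\<And>z. bij_betw (\<rho> z) P {..<card P}"
    "\<And>z x y. x \<in> P \<Longrightarrow> y \<in> P \<Longrightarrow> \<rho> z x < \<rho> z y \<longleftrightarrow> c z x < c z y"
    by metis
  define I where "I = (UNIV :: ('d \<Rightarrow> bool) set) \<times> {..<l} \<times> (digits l :: ('d \<Rightarrow> int) set)"
  have fI: "finite I" by (auto simp: I_def digits)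
  have "card I = 2 ^ CARD('d) * l * (2 ^ l) ^ CARD('d)"
    by (simp add: I_def card_cartesian_product digits card_fun)
  hence "card (\<rho> ` I) \<le> 2 ^ CARD('d) * l * (2 ^ l) ^ CARD('d)"
    using card_image_le [OF fI, of \<rho>] by simp
  moreover have "\<exists>z\<in>I. separates (\<rho> z) P ?\<delta> u v \<or> separates (\<rho> z) P ?\<delta> v u"
    if uv: "u \<in> P" "v \<in> P" "u \<noteq> v" for u v
  proof -
    have D: "0 < dist u v" using uv by simp
    obtain k where k: "3 * dist u v * 2 ^ k < W" "W \<le> 2 * (3 * dist u v) * 2 ^ k"
      using ex_dyadic_scale [of "3 * dist u v" W] W [OF uv] D by auto
    obtain s where s: "cell W s k u = cell W s k v"
      using ex_shift_same_cell [OF W0 k(1)] by blast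
    have close: "dist x y \<le> ?\<delta> * dist u v" if "cell W s (k + l) x = cell W s (k + l) y" for x y
    proof -
      have "dist x y \<le> ?d * (W / 2 ^ (k + l))" by (rule same_cell_dist [OF that W0])
      also have "\<dots> \<le> ?d * (6 * dist u v / 2 ^ l)"
        using k(2) by (intro mult_left_mono) (auto simp: power_add field_simps)
      finally show ?thesis by (simp add: field_simps)
    qed
    define r where "r = k mod l"
    define j where "j = k div l"
    have k_eq: "k = r + j * l" by (simp add: r_def j_def)
    \<comment> \<open>The digit of the children must be among the digits of the code of depth
      \<open>J\<close>.\<close>
    have "Suc j \<le> J"
    proof -
      have "\<mu> * 2 ^ k \<le> dist u v * 2 ^ k" using \<mu>' [OF uv] by (intro mult_right_mono) auto
      also have "\<dots> \<le> 3 * dist u v * 2 ^ k" using D by simp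
      also have "\<dots> < W" by (rule k(1))
      also have "W \<le> ?d * W" using d W0 by simp
      also have "\<dots> < \<mu> * 2 ^ J" by (rule J)
      finally have "(2::real) ^ k < 2 ^ J" using \<mu> by simp
      hence "k < J" by (rule power_less_imp_less_exp [rotated]) simp
      moreover have "j \<le> k" by (simp add: j_def)
      ultimately show ?thesis by simp
    qed
    let ?a = "\<lambda>x i. cell W s (k + l) x i mod 2 ^ l"
    have "?a x \<in> digits l" for x by (simp add: digits_def)
    then obtain t where t: "t \<in> digits l" "\<kappa> t (?a u) div 2 = \<kappa> t (?a v) div 2"
      using \<kappa>(3) by blast
    define z where "z = (s, r, t)"
    have z: "z \<in> I" using t l0 by (simp add: z_def I_def r_def)
    have sep: "separates (c z) P ?\<delta> x y"
      if "c z x < c z y" "(x, y) = (u, v) \<or> (x, y) = (v, u)" for x y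
    proof -
      have "separates (code W s l r (\<kappa> t) J) P ?\<delta> x y"
      proof (rule separates_code [OF \<kappa>(1,2) _ _ \<open>Suc j \<le> J\<close>])
        show "cell W s (r + j * l) x = cell W s (r + j * l) y"
          using s that(2) by (auto simp flip: k_eq)
        show "\<kappa> t (\<lambda>i. cell W s (r + j * l + l) x i mod 2 ^ l) div 2
            = \<kappa> t (\<lambda>i. cell W s (r + j * l + l) y i mod 2 ^ l) div 2"
          using t(2) that(2) by (auto simp flip: k_eq)
        show "dist p q \<le> ?\<delta> * dist x y" if "cell W s (r + j * l + l) p = cell W s (r + j * l + l) q" for p q
          using close [of p q] that \<open>(x, y) = (u, v) \<or> (x, y) = (v, u)\<close>
          by (auto simp: dist_commute simp flip: k_eq)
      qed (use that in \<open>auto simp: c_def z_def\<close>)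
      thus ?thesis by (simp add: c_def z_def)
    qed
    \<comment> \<open>Equal codes would put \<open>u\<close> and \<open>v\<close> into the same
      child, whose diameter is less than their distance because the ratio is below 1.\<close>
    have "c z u \<noteq> c z v"
    proof
      assume "c z u = c z v"
      hence J_eq: "code W s l r (\<kappa> t) J u = code W s l r (\<kappa> t) J v"
        by (simp add: c_def z_def)
      have "code W s l r (\<kappa> t) (Suc j) p \<le> code W s l r (\<kappa> t) (Suc j) q"
        if "code W s l r (\<kappa> t) J p \<le> code W s l r (\<kappa> t) J q" for p q
        by (rule code_mono [OF \<kappa>(1,2) that \<open>Suc j \<le> J\<close>])
      hence "code W s l r (\<kappa> t) (Suc j) u = code W s l r (\<kappa> t) (Suc j) v"
        using J_eq by (metis order_antisym order_refl)
      hence "cell W s (r + Suc j * l) u = cell W s (r + Suc j * l) v"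
        by (subst (asm) code_eq_iff [OF \<kappa>(1,2)])
      hence "cell W s (k + l) u = cell W s (k + l) v"
        by (simp add: k_eq add_ac)
      hence "dist u v \<le> ?\<delta> * dist u v" by (rule close)
      thus False using mult_strict_right_mono [OF \<delta> D] by linarith
    qed
    moreover have "separates (\<rho> z) P ?\<delta> x y" if "separates (c z) P ?\<delta> x y" "x \<in> P" "y \<in> P" for x y
      using that by (rule separates_cong) (rule \<rho>(2))
    ultimately have "separates (\<rho> z) P ?\<delta> u v \<or> separates (\<rho> z) P ?\<delta> v u"
      using sep [of u v] sep [of v u] uv by (metis linorder_neqE_nat)
    thus ?thesis using z by blast
  qed
  ultimately show ?thesis using fI \<rho>(1) by (intro exI [of _ "\<rho> ` I"]) auto
qed

text \<open>The ratio \<open>2 ^ l\<close> is chosen between \<open>36 * d / \<epsilon>\<close> and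
  \<open>72 * d / \<epsilon>\<close>: large enough for precision \<open>\<epsilon> / 6\<close>, and
  small enough for the count, with \<open>l\<close> of order
  \<open>ln (2 / \<epsilon>)\<close>.\<close>

lemma ex_locality_sensitive_orders:
  "\<exists>C>0. \<forall>(P :: (real ^ 'd::finite) set) (\<epsilon>::real). finite P \<longrightarrow> 0 < \<epsilon> \<longrightarrow> \<epsilon> < 1 \<longrightarrow>
     (\<exists>S. finite S \<and> real (card S) \<le> C * (\<epsilon> powr (- real CARD('d)) * ln (2 / \<epsilon>)) \<and>
     (\<forall>\<sigma>\<in>S. bij_betw \<sigma> P {..<card P}) \<and>
     (\<forall>u\<in>P. \<forall>v\<in>P. u \<noteq> v \<longrightarrow> (\<exists>\<sigma>\<in>S. separates \<sigma> P (\<epsilon> / 6) u v \<or> separates \<sigma> P (\<epsilon> / 6) v u)))"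
proof -
  let ?d = "real CARD('d)"
  have d: "1 \<le> ?d" by simp
  \<comment> \<open>\<open>C1\<close> absorbs the constant \<open>ln (36 * d)\<close> into a
    multiple of \<open>ln (2 / \<epsilon>)\<close>, which is at least \<open>ln 2\<close>.\<close>
  define C1 where "C1 = (ln (36 * ?d) / ln 2 + 1) / ln 2"
  have "0 \<le> ln (36 * ?d)" using d by (intro ln_ge_zero) linarith
  hence C1: "0 < C1" unfolding C1_def by (intro divide_pos_pos add_nonneg_pos divide_nonneg_pos) auto
  define C where "C = 2 ^ CARD('d) * C1 * (72 * ?d) ^ CARD('d)"
  have "0 < C" using C1 d by (simp add: C_def)
  moreover have "\<exists>S. finite S \<and> real (card S) \<le> C * (\<epsilon> powr (- ?d) * ln (2 / \<epsilon>)) \<and>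
     (\<forall>\<sigma>\<in>S. bij_betw \<sigma> P {..<card P}) \<and>
     (\<forall>u\<in>P. \<forall>v\<in>P. u \<noteq> v \<longrightarrow> (\<exists>\<sigma>\<in>S. separates \<sigma> P (\<epsilon> / 6) u v \<or> separates \<sigma> P (\<epsilon> / 6) v u))"
    if "finite P" "0 < \<epsilon>" "\<epsilon> < 1" for P :: "(real ^ 'd) set" and \<epsilon> :: real
  proof -
    define y where "y = 36 * ?d / \<epsilon>"
    have y: "36 * ?d < y" using that d by (simp add: y_def field_simps)
    hence y1: "1 < y" using d by linarith
    obtain l where l: "1 * 2 ^ l < 2 * y" "2 * y \<le> 2 * 1 * 2 ^ l"
      using ex_dyadic_scale [of 1 "2 * y"] y1 by auto
    have "real (6 * CARD('d)) < real (2 ^ l)" using y l d by simp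
    hence "6 * CARD('d) < 2 ^ l" using of_nat_less_iff by blast
    from ex_dyadic_orders [OF that(1) this] obtain S where S:
      "finite S" "card S \<le> 2 ^ CARD('d) * l * (2 ^ l) ^ CARD('d)"
      "\<forall>\<sigma>\<in>S. bij_betw \<sigma> P {..<card P}"
      "\<forall>u\<in>P. \<forall>v\<in>P. u \<noteq> v \<longrightarrow>
        (\<exists>\<sigma>\<in>S. separates \<sigma> P (6 * CARD('d) / 2 ^ l) u v \<or> separates \<sigma> P (6 * CARD('d) / 2 ^ l) v u)"
      by blast
    have \<delta>: "6 * CARD('d) / 2 ^ l \<le> \<epsilon> / 6"
      using l(2) that by (simp add: y_def field_simps)
    have ln2: "ln 2 \<le> ln (2 / \<epsilon>)" using that by (simp add: ln_div)
    hence ln0: "0 \<le> ln (2 / \<epsilon>)" using ln_gt_zero [of "2 :: real"] by linarith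
    have "real l * ln 2 = ln (2 ^ l)" by (simp add: ln_realpow)
    also have "\<dots> \<le> ln (2 * y)" using l(1) y1 by (subst ln_le_cancel_iff) auto
    also have "2 * y = 36 * ?d * (2 / \<epsilon>)" by (simp add: y_def)
    also have "ln \<dots> = ln (36 * ?d) + ln (2 / \<epsilon>)" using that d by (subst ln_mult) auto
    also have "ln (36 * ?d) \<le> ln (36 * ?d) / ln 2 * ln (2 / \<epsilon>)"
      using mult_left_mono [OF ln2, of "ln (36 * ?d) / ln 2"] d by simp
    finally have "real l * ln 2 \<le> (ln (36 * ?d) / ln 2 + 1) * ln (2 / \<epsilon>)"
      by (simp add: algebra_simps)
    hence ll: "real l \<le> C1 * ln (2 / \<epsilon>)"
      by (simp add: C1_def field_simps)
    have "real (card S) \<le> real (2 ^ CARD('d) * l * (2 ^ l) ^ CARD('d))"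
      using S(2) of_nat_le_iff by blast
    also have "\<dots> = 2 ^ CARD('d) * real l * (2 ^ l) ^ CARD('d)" by simp
    also have "\<dots> \<le> 2 ^ CARD('d) * (C1 * ln (2 / \<epsilon>)) * (2 * y) ^ CARD('d)"
      using ll l(1) C1 ln0 by (intro mult_mono power_mono mult_nonneg_nonneg) auto
    also have "(2 * y) ^ CARD('d) = (72 * ?d) ^ CARD('d) * \<epsilon> powr (- ?d)"
    proof -
      have "2 * y = 72 * ?d * inverse \<epsilon>" by (simp add: y_def field_simps)
      moreover have "inverse \<epsilon> ^ CARD('d) = \<epsilon> powr (- ?d)"
        using that by (simp only: powr_minus powr_realpow power_inverse)
      ultimately show ?thesis by (simp only: power_mult_distrib)
    qed
    also have "2 ^ CARD('d) * (C1 * ln (2 / \<epsilon>)) * ((72 * ?d) ^ CARD('d) * \<epsilon> powr (- ?d))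
        = C * (\<epsilon> powr (- ?d) * ln (2 / \<epsilon>))"
      by (simp add: C_def)
    finally have card: "real (card S) \<le> C * (\<epsilon> powr (- ?d) * ln (2 / \<epsilon>))" .
    have "\<exists>\<sigma>\<in>S. separates \<sigma> P (\<epsilon> / 6) u v \<or> separates \<sigma> P (\<epsilon> / 6) v u"
      if uv: "u \<in> P" "v \<in> P" "u \<noteq> v" for u v
    proof -
      obtain \<sigma> where "\<sigma> \<in> S"
        "separates \<sigma> P (6 * CARD('d) / 2 ^ l) u v \<or> separates \<sigma> P (6 * CARD('d) / 2 ^ l) v u"
        using S(4) uv by blast
      thus ?thesis using separates_mono [OF _ \<delta>] by blast
    qed
    with card S(1,3) show ?thesis by blast
  qed
  ultimately show ?thesis by blast
qed

section \<open>Union of the graphs of all orders\<close>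

lemma short_connectedI:
  fixes u v :: "'a::metric_space"
  assumes "distinct [u, a, x, b, v]" "{u, a, x, b, v} \<subseteq> verts H"
    and "{u, a} \<in> edges H" "{a, x} \<in> edges H" "{x, b} \<in> edges H" "{b, v} \<in> edges H"
    and "dist u a + dist a x + dist x b + dist b v \<le> (1 + \<epsilon>) * dist u v"
  shows "short_connected H 4 \<epsilon> u v"
  unfolding short_connected_def
proof (intro exI conjI)
  show "is_path H [u, a, x, b, v]"
    using assms by (auto simp: is_path_def less_Suc_eq)
  show "path_length [u, a, x, b, v] \<le> (1 + \<epsilon>) * dist u v"
    using assms(7) by (simp add: path_length_def num_edges_def eval_nat_numeral)
qed (auto simp: num_edges_def)

lemma short_connected_separated:
  fixes u v :: "'a::metric_space"
  assumes sep: "separates \<sigma> P (\<epsilon> / 6) u v" and P: "{u, a, x, b, v} \<subseteq> P" and H: "verts H = P"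
    and less: "\<sigma> u < \<sigma> a" "\<sigma> a < \<sigma> x" "\<sigma> x < \<sigma> b" "\<sigma> b < \<sigma> v"
    and edges: "{u, a} \<in> edges H" "{a, x} \<in> edges H" "{x, b} \<in> edges H" "{b, v} \<in> edges H"
  shows "short_connected H 4 \<epsilon> u v" "short_connected H 4 \<epsilon> v u"
proof -
  obtain U where U: "\<forall>x\<in>P. \<forall>y\<in>P. \<sigma> x \<le> \<sigma> y \<longrightarrow> y \<in> U \<longrightarrow> x \<in> U"
    "\<forall>x\<in>P. \<sigma> u \<le> \<sigma> x \<longrightarrow> \<sigma> x \<le> \<sigma> v \<longrightarrow> (if x \<in> U then dist u x else dist x v) \<le> \<epsilon> / 6 * dist u v"
    using sep unfolding separates_def by blast
  have near: "(if w \<in> U then dist u w else dist w v) \<le> \<epsilon> / 6 * dist u v" if "w \<in> {a, x, b}" for w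
    using that U(2) P less by auto
  have down: "x \<in> U \<Longrightarrow> a \<in> U" "b \<in> U \<Longrightarrow> x \<in> U"
    using U(1) P less by (auto intro: less_imp_le)
  have hop: "dist p q \<le> dist u p + dist u q" "dist p q \<le> dist p v + dist q v"
    "dist p q \<le> dist u p + dist u v + dist q v" for p q
    using dist_triangle [of p q u] dist_triangle [of p q v] dist_triangle [of u q v]
    by (simp_all add: dist_commute)
  \<comment> \<open>Exactly one hop crosses from \<open>U\<close> to its complement and pays
    \<open>dist u v\<close>. Each of the three inner vertices enters two hops and adds its distance
    to the nearby end at most twice, which explains the six terms
    \<open>\<epsilon> / 6\<close>.\<close>
  have "dist u a + dist a x + dist x b + dist b v \<le> dist u v + 6 * (\<epsilon> / 6 * dist u v)"
    using near [of a] near [of x] near [of b] down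
      hop [of a x] hop [of x b] dist_triangle [of b v u] dist_triangle [of u a v]
    by (cases "a \<in> U"; cases "x \<in> U"; cases "b \<in> U") (simp_all add: dist_commute)
  hence le: "dist u a + dist a x + dist x b + dist b v \<le> (1 + \<epsilon>) * dist u v"
    by (simp add: algebra_simps)
  have distinct: "distinct [u, a, x, b, v]" using less by auto
  show "short_connected H 4 \<epsilon> u v"
    using P H by (intro short_connectedI [OF distinct _ edges le]) auto
  show "short_connected H 4 \<epsilon> v u"
    using P H distinct edges le
    by (intro short_connectedI [of v b x a u]) (auto simp: insert_commute dist_commute algebra_simps)
qed

text \<open>Every bad pair comes from at least one ordered pair, so their number is at most a sum of
  indicators; then expectation is linear.\<close>

lemma expected_bad_pairs_le:
  fixes G :: "'a::metric_space ugraph"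
  assumes "finite (verts G)" "finite (edges G)"
  shows "measure_pmf.expectation (random_subgraph G \<psi>) (\<lambda>H. real (card (bad_pairs H k \<epsilon>)))
    \<le> (\<Sum>(u, v)\<in>verts G \<times> verts G - Id.
        measure_pmf.prob (Pi_pmf (edges G) False (\<lambda>_. bernoulli_pmf \<psi>))
          {f. \<not> short_connected (verts G, {e\<in>edges G. f e}) k \<epsilon> u v})"
proof -
  let ?p = "Pi_pmf (edges G) False (\<lambda>_. bernoulli_pmf \<psi>)"
  let ?H = "\<lambda>f. (verts G, {e\<in>edges G. f e})"
  let ?I = "verts G \<times> verts G - Id"
  let ?bad = "\<lambda>f (u, v). \<not> short_connected (?H f) k \<epsilon> u v"
  have fin: "finite (set_pmf ?p)"
    using assms(2) by (subst set_Pi_pmf) auto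
  have int: "integrable ?p g" for g :: "_ \<Rightarrow> real"
    by (rule integrable_measure_pmf_finite [OF fin])
  have fI: "finite ?I" using assms(1) by auto
  have card: "real (card (bad_pairs (?H f) k \<epsilon>)) \<le> (\<Sum>z\<in>?I. indicator {f. ?bad f z} f)" for f
  proof -
    have "bad_pairs (?H f) k \<epsilon> \<subseteq> (\<lambda>(u, v). {u, v}) ` {z\<in>?I. ?bad f z}"
      by (auto simp: bad_pairs_def)
    moreover have "finite {z\<in>?I. ?bad f z}" by (rule finite_subset [OF _ fI]) blast
    ultimately have "card (bad_pairs (?H f) k \<epsilon>) \<le> card {z\<in>?I. ?bad f z}"
      by (intro card_le_image)
    also have "real (card {z\<in>?I. ?bad f z}) = (\<Sum>z\<in>?I. indicator {f. ?bad f z} f)"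
      using fI by (simp add: indicator_def sum.If_cases Int_def)
    finally show ?thesis by simp
  qed
  have "measure_pmf.expectation (random_subgraph G \<psi>) (\<lambda>H. real (card (bad_pairs H k \<epsilon>)))
    = measure_pmf.expectation ?p (\<lambda>f. real (card (bad_pairs (?H f) k \<epsilon>)))"
    by (simp add: random_subgraph_def)
  also have "\<dots> \<le> measure_pmf.expectation ?p (\<lambda>f. \<Sum>z\<in>?I. indicator {f. ?bad f z} f)"
    by (intro integral_mono int card)
  also have "\<dots> = (\<Sum>z\<in>?I. measure_pmf.expectation ?p (indicator {f. ?bad f z}))"
    by (intro Bochner_Integration.integral_sum int)
  also have "\<dots> = (\<Sum>z\<in>?I. measure_pmf.prob ?p {f. ?bad f z})"
    by simp
  also have "\<dots> = (\<Sum>(u, v)\<in>?I. measure_pmf.prob ?p {f. \<not> short_connected (?H f) k \<epsilon> u v})"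
    by (intro sum.cong) auto
  finally show ?thesis .
qed

text \<open>Each pair is served by the order that separates it. The constants come from
  \<open>K \<le> 9 * \<psi> powr (- 4 / 3)\<close> and \<open>Suc s \<le> 3 * ln n\<close>: 20 * 9 *
  3 = 540 for the edges and 56 * 9 \<le> 540 for the bad pairs.\<close>

lemma ex_dependable_graph:
  fixes P :: "'a::metric_space set"
  assumes P: "finite P" "card P = n" and \<psi>: "0 < \<psi>" "\<psi> < 1" and n: "2 \<le> n"
    and S: "finite S" "\<And>\<sigma>. \<sigma> \<in> S \<Longrightarrow> bij_betw \<sigma> P {..<n}"
      "\<And>u v. u \<in> P \<Longrightarrow> v \<in> P \<Longrightarrow> u \<noteq> v \<Longrightarrow>
         \<exists>\<sigma>\<in>S. separates \<sigma> P (\<epsilon> / 6) u v \<or> separates \<sigma> P (\<epsilon> / 6) v u"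
  shows "\<exists>G. finite_simple_graph G \<and> verts G = P \<and>
     real (card (edges G)) \<le> 540 * real (card S) * \<psi> powr (- 4 / 3) * real n * ln (real n) \<and>
     measure_pmf.expectation (random_subgraph G \<psi>) (\<lambda>H. real (card (bad_pairs H 4 \<epsilon>)))
       \<le> 540 * real (card S) * \<psi> powr (- 4 / 3) * real n"
proof -
  define K where "K = nat \<lceil>8 * \<psi> powr (- 4 / 3)\<rceil>"
  have K: "8 * \<psi> powr (- 4 / 3) \<le> real K" unfolding K_def by linarith
  have "1 \<le> \<psi> powr (- 4 / 3)"
    using \<psi> powr_mono' [of "- 4 / 3" 0 \<psi>] by simp
  hence K9: "real K \<le> 9 * \<psi> powr (- 4 / 3)" and K0: "0 < K"
    unfolding K_def by linarith+
  obtain s where s: "2 ^ s \<le> n" "n < 2 ^ (s + 1)"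
    using ex_power_ivl1 [of 2 n] n by auto
  have Suc_s: "real (Suc s) \<le> 3 * ln (real n)"
  proof -
    have "s \<noteq> 0" using s n by (intro notI) simp
    have "real s * (2 / 3) \<le> real s * ln 2"
      using ln2_ge_two_thirds by (intro mult_left_mono) auto
    also have "\<dots> = ln (real (2 ^ s))" by (simp add: ln_realpow)
    also have "\<dots> \<le> ln (real n)"
      using s(1) n by (subst ln_le_cancel_iff) (auto simp flip: of_nat_power)
    finally show ?thesis using \<open>s \<noteq> 0\<close> by simp
  qed
  define F where "F = (\<Union>\<sigma>\<in>S. order_edges K s P \<sigma>)"
  have fF: "finite F" unfolding F_def using S order_edges(1) K0 by blast
  define G where "G = (P, F)"
  have "finite_simple_graph G"
    using P(1) order_edges(3) [OF S(2) K0, of _ _ s] unfolding finite_simple_graph_def G_def F_def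
    by auto
  moreover have "real (card (edges G)) \<le> 540 * real (card S) * \<psi> powr (- 4 / 3) * real n * ln (real n)"
  proof -
    have "card F \<le> (\<Sum>\<sigma>\<in>S. card (order_edges K s P \<sigma>))"
      unfolding F_def by (rule card_UN_le [OF S(1)])
    also have "\<dots> \<le> (\<Sum>\<sigma>\<in>S. 20 * n * K * Suc s)"
      by (intro sum_mono order_edges(2) S K0)
    finally have "real (card F) \<le> real (card S * (20 * n * K * Suc s))"
      by (simp only: of_nat_le_iff sum_constant of_nat_id)
    also have "\<dots> = real (card S) * 20 * real n * (real K * real (Suc s))"
      by (simp only: of_nat_mult of_nat_numeral mult_ac)
    also have "\<dots> \<le> real (card S) * 20 * real n * ((9 * \<psi> powr (- 4 / 3)) * (3 * ln (real n)))"
      by (intro mult_left_mono mult_mono K9 Suc_s) auto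
    finally show ?thesis by (simp add: G_def mult_ac)
  qed
  moreover have "measure_pmf.expectation (random_subgraph G \<psi>) (\<lambda>H. real (card (bad_pairs H 4 \<epsilon>)))
       \<le> 540 * real (card S) * \<psi> powr (- 4 / 3) * real n"
  proof -
    let ?I = "P \<times> P - Id"
    let ?p = "Pi_pmf F False (\<lambda>_. bernoulli_pmf \<psi>)"
    let ?b = "\<lambda>\<sigma> u v. failure_bound K (max (\<sigma> u) (\<sigma> v) - min (\<sigma> u) (\<sigma> v))"
    have pair: "measure_pmf.prob ?p {f. \<not> short_connected (P, {e\<in>F. f e}) 4 \<epsilon> u v} \<le> (\<Sum>\<sigma>\<in>S. ?b \<sigma> u v)"
      if uv: "u \<in> P" "v \<in> P" "u \<noteq> v" for u v
    proof -
      obtain \<sigma> where \<sigma>: "\<sigma> \<in> S"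
        and sep': "separates \<sigma> P (\<epsilon> / 6) u v \<or> separates \<sigma> P (\<epsilon> / 6) v u"
        using S(3) [OF uv] by blast
      obtain y z where yz: "(y, z) = (u, v) \<or> (y, z) = (v, u)" and sep: "separates \<sigma> P (\<epsilon> / 6) y z"
        by (rule disjE [OF sep']) (erule that [rotated], simp)+
      have yz': "y \<in> P" "z \<in> P" "\<sigma> y < \<sigma> z"
        using uv yz sep by (auto simp: separates_def)
      have F': "order_edges K s P \<sigma> \<subseteq> F" using \<sigma> by (auto simp: F_def)
      let ?chain = "\<lambda>f a x b. \<sigma> y < \<sigma> a \<and> \<sigma> a < \<sigma> x \<and> \<sigma> x < \<sigma> b \<and> \<sigma> b < \<sigma> z \<and>
         f {y, a} \<and> f {a, x} \<and> f {x, b} \<and> f {b, z}"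
      have "short_connected (P, {e\<in>F. f e}) 4 \<epsilon> u v"
        if f: "f \<in> set_pmf ?p" and chain: "?chain f a x b" "a \<in> P" "x \<in> P" "b \<in> P" for f a x b
      proof -
        \<comment> \<open>Outside \<open>F\<close> the product distribution takes the default value
          \<open>False\<close>.\<close>
        have "e \<in> F" if "f e" for e
          using subsetD [OF set_Pi_pmf_subset [OF fF] f] that by auto
        hence "{{y, a}, {a, x}, {x, b}, {b, z}} \<subseteq> {e\<in>F. f e}" using chain(1) by simp
        hence "short_connected (P, {e\<in>F. f e}) 4 \<epsilon> y z" "short_connected (P, {e\<in>F. f e}) 4 \<epsilon> z y"
          using chain yz'(1,2)
          by (intro short_connected_separated [OF sep, where a = a and x = x and b = b]; simp)+
        thus ?thesis using yz by auto
      qed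
      hence "measure_pmf.prob ?p {f. \<not> short_connected (P, {e\<in>F. f e}) 4 \<epsilon> u v}
        \<le> measure_pmf.prob ?p {f. \<not> (\<exists>a\<in>P. \<exists>x\<in>P. \<exists>b\<in>P. ?chain f a x b)}"
        by (intro measure_pmf.finite_measure_mono_AE AE_pmfI) auto
      also have "\<dots> \<le> failure_bound K (\<sigma> z - \<sigma> y)"
        using s(2) by (intro prob_order_failure [OF S(2) [OF \<sigma>] fF F' \<psi> K _ yz']) simp
      also have "\<dots> = ?b \<sigma> u v" using yz yz'(3) by auto
      \<comment> \<open>The separating order depends on the pair; summing over all orders removes
        this dependence and allows the sums to be exchanged.\<close>
      also have "\<dots> \<le> (\<Sum>\<sigma>\<in>S. ?b \<sigma> u v)"
        using \<sigma> S(1) by (intro member_le_sum) (auto simp: failure_bound_nonneg)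
      finally show ?thesis .
    qed
    have "measure_pmf.expectation (random_subgraph G \<psi>) (\<lambda>H. real (card (bad_pairs H 4 \<epsilon>)))
      \<le> (\<Sum>(u, v)\<in>?I. measure_pmf.prob ?p {f. \<not> short_connected (P, {e\<in>F. f e}) 4 \<epsilon> u v})"
      using expected_bad_pairs_le [of G \<psi> 4 \<epsilon>] P(1) fF by (simp add: G_def)
    also have "\<dots> \<le> (\<Sum>(u, v)\<in>?I. \<Sum>\<sigma>\<in>S. ?b \<sigma> u v)"
      using pair by (intro sum_mono) auto
    also have "\<dots> = (\<Sum>\<sigma>\<in>S. \<Sum>(u, v)\<in>?I. ?b \<sigma> u v)"
      unfolding case_prod_unfold by (rule sum.swap)
    also have "\<dots> \<le> (\<Sum>\<sigma>\<in>S. 56 * real n * real K)"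
      by (intro sum_mono sum_failure_bound_pairs_le S K0)
    also have "\<dots> = 56 * real (card S) * real n * real K" by simp
    also have "\<dots> \<le> 56 * real (card S) * real n * (540 / 56 * \<psi> powr (- 4 / 3))"
      using K9 \<open>1 \<le> \<psi> powr (- 4 / 3)\<close> by (intro mult_left_mono) auto
    finally show ?thesis by (simp add: mult_ac)
  qed
  ultimately show ?thesis by (intro exI [of _ G]) (simp add: G_def)
qed

theorem theorem6p2:
  "\<exists>c::real. c > 0 \<and>
     (\<forall>(P :: (real ^ 'd::finite) set) (n::nat) (\<psi>::real) (\<epsilon>::real) (C\<epsilon>::real) (C\<psi>::real).
        finite P \<longrightarrow> card P = n \<longrightarrow>
        0 < \<psi> \<longrightarrow> \<psi> < 1 \<longrightarrow> 0 < \<epsilon> \<longrightarrow> \<epsilon> < 1 \<longrightarrow>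
        C\<epsilon> = c * \<epsilon> powr (- real CARD('d)) * ln (2 / \<epsilon>) \<longrightarrow>
        C\<psi> = c * \<psi> powr (- 4 / 3) \<longrightarrow>
        (\<exists>G :: (real ^ 'd) ugraph.
           finite_simple_graph G \<and> verts G = P \<and>
           real (card (edges G)) \<le> c * (C\<epsilon> / \<psi> powr (4 / 3)) * real n * ln (real n) \<and>
           measure_pmf.expectation (random_subgraph G \<psi>)
             (\<lambda>H. real (card (bad_pairs H 4 \<epsilon>))) \<le> c * C\<epsilon> * C\<psi> * real n))"
proof -
  obtain C where C: "0 < C" and orders: "\<forall>(P :: (real ^ 'd) set) \<epsilon>::real. finite P \<longrightarrow> 0 < \<epsilon> \<longrightarrow> \<epsilon> < 1 \<longrightarrow>
     (\<exists>S. finite S \<and> real (card S) \<le> C * (\<epsilon> powr (- real CARD('d)) * ln (2 / \<epsilon>)) \<and>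
     (\<forall>\<sigma>\<in>S. bij_betw \<sigma> P {..<card P}) \<and>
     (\<forall>u\<in>P. \<forall>v\<in>P. u \<noteq> v \<longrightarrow> (\<exists>\<sigma>\<in>S. separates \<sigma> P (\<epsilon> / 6) u v \<or> separates \<sigma> P (\<epsilon> / 6) v u)))"
    using ex_locality_sensitive_orders [where 'd = 'd] by (elim exE conjE)
  \<comment> \<open>Since \<open>C\<epsilon>\<close> and \<open>C\<psi>\<close> contain
    \<open>c\<close> themselves, the bounds carry \<open>c^2\<close> and \<open>c^3\<close>;
    \<open>c \<ge> 1\<close> makes both at least \<open>540 * C\<close>.\<close>
  define c where "c = 1 + 540 * C"
  have c: "1 \<le> c" "540 * C \<le> c" using C by (auto simp: c_def)
  hence c2: "540 * C \<le> c * c" "540 * C \<le> c * c * c"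
    using mult_mono [of "540 * C" c 1 c] mult_mono [of "540 * C" "c * c" 1 c] C by auto
  have "\<exists>G :: (real ^ 'd) ugraph.
           finite_simple_graph G \<and> verts G = P \<and>
           real (card (edges G)) \<le> c * (c * \<epsilon> powr (- real CARD('d)) * ln (2 / \<epsilon>) / \<psi> powr (4 / 3)) * real n * ln (real n) \<and>
           measure_pmf.expectation (random_subgraph G \<psi>)
             (\<lambda>H. real (card (bad_pairs H 4 \<epsilon>)))
           \<le> c * (c * \<epsilon> powr (- real CARD('d)) * ln (2 / \<epsilon>)) * (c * \<psi> powr (- 4 / 3)) * real n"
    if P: "finite P" "card P = n" and \<psi>: "0 < \<psi>" "\<psi> < 1" and \<epsilon>: "0 < \<epsilon>" "\<epsilon> < 1"
    for P :: "(real ^ 'd) set" and n \<psi> \<epsilon>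
  proof -
    define X where "X = \<epsilon> powr (- real CARD('d)) * ln (2 / \<epsilon>)"
    define Y where "Y = \<psi> powr (- 4 / 3)"
    have Y: "1 / \<psi> powr (4 / 3) = Y" by (simp add: Y_def powr_minus_divide flip: minus_divide_left)
    have X0: "0 \<le> X" using \<epsilon> by (simp add: X_def)
    have Y0: "0 \<le> Y" by (simp add: Y_def)
    have "\<exists>G. finite_simple_graph G \<and> verts G = P \<and>
       real (card (edges G)) \<le> 540 * C * (X * Y * real n * ln (real n)) \<and>
       measure_pmf.expectation (random_subgraph G \<psi>) (\<lambda>H. real (card (bad_pairs H 4 \<epsilon>)))
         \<le> 540 * C * (X * Y * real n)"
    proof (cases "2 \<le> n")
      case True
      obtain S where S: "finite S" "real (card S) \<le> C * X" "\<forall>\<sigma>\<in>S. bij_betw \<sigma> P {..<n}"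
        "\<forall>u\<in>P. \<forall>v\<in>P. u \<noteq> v \<longrightarrow> (\<exists>\<sigma>\<in>S. separates \<sigma> P (\<epsilon> / 6) u v \<or> separates \<sigma> P (\<epsilon> / 6) v u)"
        using orders [THEN spec, THEN spec, THEN mp, THEN mp, THEN mp, OF P(1) \<epsilon>]
        unfolding X_def P(2) by (elim exE conjE)
      obtain G where G: "finite_simple_graph G" "verts G = P"
        "real (card (edges G)) \<le> 540 * real (card S) * Y * real n * ln (real n)"
        "measure_pmf.expectation (random_subgraph G \<psi>) (\<lambda>H. real (card (bad_pairs H 4 \<epsilon>)))
           \<le> 540 * real (card S) * Y * real n"
        using ex_dependable_graph [OF P \<psi> True S(1), of \<epsilon>] S(3,4) unfolding Y_def by blast
      have "540 * real (card S) * Y * real n * ln (real n) \<le> 540 * (C * X) * Y * real n * ln (real n)"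
        "540 * real (card S) * Y * real n \<le> 540 * (C * X) * Y * real n"
        using S(2) Y0 True by (intro mult_right_mono mult_left_mono; simp)+
      with G show ?thesis by (intro exI [of _ G]) (simp add: mult_ac)
    next
      \<comment> \<open>With at most one point \<open>ln n\<close> is 0 (also for
        \<open>n = 0\<close>, by the convention for \<open>ln 0\<close>), so the graph has to be
        edgeless, and there is no pair to connect.\<close>
      case False
      have "card P \<le> Suc 0" using False P by simp
      hence "P \<times> P - Id = {}"
        using P(1) by (auto simp: card_le_Suc0_iff_eq)
      moreover have "ln (real n) = 0" using False by (cases n) auto
      moreover have "measure_pmf.expectation (random_subgraph (P, {}) \<psi>)
          (\<lambda>H. real (card (bad_pairs H 4 \<epsilon>))) \<le> 0"
        using expected_bad_pairs_le [of "(P, {})" \<psi> 4 \<epsilon>] P(1)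
        by (simp only: fst_conv snd_conv \<open>P \<times> P - Id = {}\<close> sum.empty finite.emptyI)
      moreover have "0 \<le> 540 * C * (X * Y * real n)" using C X0 Y0 by simp
      ultimately show ?thesis
        using P(1) by (intro exI [of _ "(P, {})"]) (simp add: finite_simple_graph_def)
    qed
    then obtain G where G: "finite_simple_graph G" "verts G = P"
       "real (card (edges G)) \<le> 540 * C * (X * Y * real n * ln (real n))"
       "measure_pmf.expectation (random_subgraph G \<psi>) (\<lambda>H. real (card (bad_pairs H 4 \<epsilon>)))
         \<le> 540 * C * (X * Y * real n)"
      by blast
    have "0 \<le> ln (real n)" by (cases n) auto
    hence "540 * C * (X * Y * real n * ln (real n)) \<le> c * c * (X * Y * real n * ln (real n))"
      using X0 Y0 by (intro mult_right_mono c2) auto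
    also have "\<dots> = c * (c * X * (1 / \<psi> powr (4 / 3))) * real n * ln (real n)"
      unfolding Y by (simp add: mult_ac)
    finally have 1: "540 * C * (X * Y * real n * ln (real n)) \<le> \<dots>" .
    have "540 * C * (X * Y * real n) \<le> c * c * c * (X * Y * real n)"
      using X0 Y0 by (intro mult_right_mono c2) auto
    also have "\<dots> = c * (c * X) * (c * Y) * real n" by (simp add: mult_ac)
    finally have 2: "540 * C * (X * Y * real n) \<le> \<dots>" .
    show ?thesis
      using G order.trans [OF G(3) 1] order.trans [OF G(4) 2]
      by (intro exI [of _ G]) (simp add: X_def Y_def mult.assoc)
  qed
  with c show ?thesis by (intro exI [of _ c]) auto
qed

end
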